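(* Let $w(z;\rho)$ be a regular semi-classical weight with singularities $z_0=0,z_1,\dots,z_M$ and exponents $\rho=(\rho_0,\dots,\rho_M)$, let $j$ be such that $z_j\ne0$, and denote by $Y_n(z;\rho_j\pm1)$, $A_n(z;\rho_j\pm1)$ the matrices $Y_n,A_n$ for the weight $(z-z_j)^{\pm1}w(z;\rho)$, where $A_n$ is the spectral matrix defined by $\frac{d}{dz}Y_n=A_nY_n$. Let $R^{j\pm}_n(z;\rho_j)$ be the Schlesinger transformation matrices, with $Y_n(z;\rho_j\pm1)=R^{j\pm}_n(z;\rho_j)Y_n(z;\rho_j)$, whose explicit forms are given in the context. Then $$\frac{d}{dz}R^{j\pm}_n(z;\rho_j)+R^{j\pm}_n(z;\rho_j)\,A_n(z;\rho_j)=A_n(z;\rho_j\pm1)\,R^{j\pm}_n(z;\rho_j)$$ (for $n\ge0$ in the $+$ case and $n\ge1$ in the $-$ case).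
   Context: $\mathbb T$ is the unit circle. For a complex-valued weight $w$ on $\mathbb T$ put $w_k=\int_{\mathbb T}\frac{d\zeta}{2\pi i\zeta}w(\zeta)\zeta^{-k}$ and $I_n[w]=\det[w_{j-k}]_{j,k=0,\dots,n-1}$, $I_0=1$. If $I_n[w]\ne0$ for all $n\ge0$, the bi-orthogonal system of $w$ is: polynomials $\phi_n,\bar\phi_n$ of degree $n$ with the same leading coefficient $\kappa_n$ satisfying $\int_{\mathbb T}\frac{d\zeta}{2\pi i\zeta}w(\zeta)\phi_m(\zeta)\bar\phi_n(\bar\zeta)=\delta_{m,n}$ with $\bar\zeta=1/\zeta$ ($\bar\phi_n$ is a separate polynomial, not in general the complex conjugate of $\phi_n$; $\kappa_n^2=I_n/I_{n+1}$, with a choice of square root $\kappa_n$ fixed for each weight); $\phi^*_n(z)=z^n\bar\phi_n(1/z)$; and the associated functions, for $z\notin\mathbb T$ and $n>0$, $\xi_n(z)=\int_{\mathbb T}\frac{d\zeta}{2\pi i\zeta}\frac{\zeta+z}{\zeta-z}w(\zeta)\phi_n(\zeta)$, $\ \xi^*_n(z)=-z^n\int_{\mathbb T}\frac{d\zeta}{2\pi i\zeta}\frac{\zeta+z}{\zeta-z}w(\zeta)\bar\phi_n(\bar\zeta)$, and $\xi_0(z)=\kappa_0[w_0+F(z)]$, $\xi^*_0(z)=\kappa_0[w_0-F(z)]$ with $F(z)=\int_{\mathbb T}\frac{d\zeta}{2\pi i\zeta}\frac{\zeta+z}{\zeta-z}w(\zeta)$. Put $$Y_n(z)=\begin{pmatrix}\phi_n(z)&\xi_n(z)/w(z)\\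 \phi^*_n(z)&-\xi^*_n(z)/w(z)\end{pmatrix},\qquad \det Y_n(z)=-\frac{2z^n}{w(z)}.$$ Regular semi-classical weights: $M\ge1$, $z_0=0,z_1,\dots,z_M$ are distinct points of $\mathbb C$, and $\frac{w'(z)}{w(z)}=\frac{2V(z)}{W(z)}=\sum_{j=0}^M\frac{\rho_j}{z-z_j}$ with $W(z)=\prod_{j=0}^M(z-z_j)$, $\deg V<M+1$, $\rho_j\in\mathbb C\setminus\mathbb Z_{\ge0}$; e.g. $w(z)=\prod_{j=0}^M(z-z_j)^{\rho_j}$, possibly with different constant factors on different arcs of $\mathbb T$. Exponents are restricted so that the trigonometric moments of all weights considered exist. Values $\xi_n(z_j),\xi^*_n(z_j)$ at a singular point on $\mathbb T$ are understood as limits. The bi-orthogonal systems of $w$ and of all shifted weights considered are assumed to exist, with $r_n\bar r_n\ne0,1$ for $n\ge1$, where $r_n=\phi_n(0)/\kappa_n$, $\bar r_n=\bar\phi_n(0)/\kappa_n$. It is known from earlier work that for such weights $A_n(z)=\sum_{j=0}^M\frac{A_{n,j}}{z-z_j}$ with $A_{n,0}=(n-\rho_0)\begin{pmatrix}1&-r_n\\0&0\end{pmatrix}$ and, for $j=1,\dots,M$, $A_{n,j}=-\frac{\rho_j}{2z_j^n}\begin{pmatrix}\phi^*_n(z_j)\xi_n(z_j)&-\phi_n(z_j)\xi_n(z_j)\\-\phi^*_n(z_j)\xi^*_n(z_j)&\phi_n(z_j)\xi^*_n(z_j)\end{pmatrix}$. Schlesinger matrices ($\kappa_n^\pm$ is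 the leading coefficient for $(z-z_j)^{\pm1}w$; $\phi_n(z_j)\ne0$ for all $n\ge0$ is assumed in the $+$ case, $\xi^*_n(z_j)\neq0$ for all $n\ge0$ in the $-$ case): $$R^{j+}_n=\frac{1}{z-z_j}\frac{\kappa^+_n}{\kappa_n}\begin{pmatrix} z-\frac{\kappa_n\phi_{n+1}(z_j)}{\kappa_{n+1}\phi_n(z_j)} & \frac{\phi_{n+1}(0)}{\kappa_{n+1}}\\ \frac{\phi^*_n(z_j)}{\phi_n(z_j)}z & -z_j\end{pmatrix},\quad R^{j-}_n=\frac{\kappa^-_n}{\kappa_n}\begin{pmatrix}\frac{\kappa_n\xi^*_n(z_j)}{\kappa_{n-1}\xi^*_{n-1}(z_j)} & \frac{\kappa_n\xi_n(z_j)}{\kappa_{n-1}\xi^*_{n-1}(z_j)}\\ \frac{\bar\phi_n(0)\xi^*_n(z_j)}{\kappa_{n-1}\xi^*_{n-1}(z_j)}\frac{z}{z_j} & 1-\frac{\kappa_n\xi^*_n(z_j)}{\kappa_{n-1}\xi^*_{n-1}(z_j)}\frac{z}{z_j}\end{pmatrix}.$$ *)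

theory Defs
  imports "HOL-Complex_Analysis.Complex_Analysis"
begin

section \<open>Bi-orthogonal systems on the unit circle\<close>

abbreviation unit_circle :: "complex set" where
  "unit_circle \<equiv> sphere 0 1"

definition circ_mean :: "(complex \<Rightarrow> complex) \<Rightarrow> complex" where
  "circ_mean f = contour_integral (circlepath 0 1) (\<lambda>\<zeta>. f \<zeta> / (2 * of_real pi * \<i> * \<zeta>))"

definition moment :: "(complex \<Rightarrow> complex) \<Rightarrow> int \<Rightarrow> complex" where
  "moment w k = circ_mean (\<lambda>\<zeta>. w \<zeta> * \<zeta> powi (- k))"

text \<open>
  Since \<open>\<zeta> powi (- k)\<close> has modulus 1 on the circle, absolute integrability of the weight is absolute
  convergence of every trigonometric moment.
\<close>

definition moments_exist :: "(complex \<Rightarrow> complex) \<Rightarrow> bool" where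
  "moments_exist w \<longleftrightarrow> (\<lambda>t. w (circlepath 0 1 t)) absolutely_integrable_on {0..1}"

text \<open>
  The leading coefficients \<open>\<kappa> n = lead_coeff (\<phi> n) = lead_coeff (\<phi>b n)\<close> are determined by the weight
  up to a sign for each \<open>n\<close>, and the choice of sign is part of the data \<open>\<phi>\<close>, \<open>\<phi>b\<close>. The existence of
  such a system is equivalent to the nonvanishing of all Toeplitz determinants of the moments.
\<close>

definition biorth_system ::
    "(complex \<Rightarrow> complex) \<Rightarrow> (nat \<Rightarrow> complex poly) \<Rightarrow> (nat \<Rightarrow> complex poly) \<Rightarrow> bool" where
  "biorth_system w \<phi> \<phi>b \<longleftrightarrow>
     (\<forall>n. degree (\<phi> n) = n \<and> degree (\<phi>b n) = n \<and> lead_coeff (\<phi> n) = lead_coeff (\<phi>b n)) \<and>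
     (\<forall>m n. circ_mean (\<lambda>\<zeta>. w \<zeta> * poly (\<phi> m) \<zeta> * poly (\<phi>b n) (1 / \<zeta>)) = (if m = n then 1 else 0))"

definition \<kappa> :: "(nat \<Rightarrow> complex poly) \<Rightarrow> nat \<Rightarrow> complex" where
  "\<kappa> \<phi> n = lead_coeff (\<phi> n)"

definition verblunsky :: "(nat \<Rightarrow> complex poly) \<Rightarrow> nat \<Rightarrow> complex" where
  "verblunsky \<phi> n = poly (\<phi> n) 0 / \<kappa> \<phi> n"

definition admissible ::
    "(complex \<Rightarrow> complex) \<Rightarrow> (nat \<Rightarrow> complex poly) \<Rightarrow> (nat \<Rightarrow> complex poly) \<Rightarrow> bool" where
  "admissible w \<phi> \<phi>b \<longleftrightarrow>
     moments_exist w \<and> biorth_system w \<phi> \<phi>b \<and>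
     (\<forall>n\<ge>1. verblunsky \<phi> n * verblunsky \<phi>b n \<noteq> 0 \<and> verblunsky \<phi> n * verblunsky \<phi>b n \<noteq> 1)"

text \<open>
  As \<open>degree (\<phi>b n) = n\<close>, the reflected polynomial is \<open>z ^ n * \<phi>b\<^sub>n (1 / z)\<close> for \<open>z \<noteq> 0\<close>.
\<close>

definition phi_star :: "(nat \<Rightarrow> complex poly) \<Rightarrow> nat \<Rightarrow> complex \<Rightarrow> complex" where
  "phi_star \<phi>b n z = poly (reflect_poly (\<phi>b n)) z"

definition xi :: "(complex \<Rightarrow> complex) \<Rightarrow> (nat \<Rightarrow> complex poly) \<Rightarrow> nat \<Rightarrow> complex \<Rightarrow> complex" where
  "xi w \<phi> n z =
     (if n = 0 then \<kappa> \<phi> 0 * (moment w 0 + circ_mean (\<lambda>\<zeta>. (\<zeta> + z) / (\<zeta> - z) * w \<zeta>))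
      else circ_mean (\<lambda>\<zeta>. (\<zeta> + z) / (\<zeta> - z) * w \<zeta> * poly (\<phi> n) \<zeta>))"

definition xi_star :: "(complex \<Rightarrow> complex) \<Rightarrow> (nat \<Rightarrow> complex poly) \<Rightarrow> nat \<Rightarrow> complex \<Rightarrow> complex" where
  "xi_star w \<phi>b n z =
     (if n = 0 then \<kappa> \<phi>b 0 * (moment w 0 - circ_mean (\<lambda>\<zeta>. (\<zeta> + z) / (\<zeta> - z) * w \<zeta>))
      else - (z ^ n) * circ_mean (\<lambda>\<zeta>. (\<zeta> + z) / (\<zeta> - z) * w \<zeta> * poly (\<phi>b n) (1 / \<zeta>)))"

text \<open>
  Value at a singular point \<open>s\<close>: on the unit circle it is the two-sided radial limit.
\<close>

definition value_at :: "(complex \<Rightarrow> complex) \<Rightarrow> complex \<Rightarrow> complex" where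
  "value_at f s = (if s \<in> unit_circle then Lim (at 1) (\<lambda>r::real. f (of_real r * s)) else f s)"

section \<open>Regular semi-classical weights and the spectral matrix\<close>

text \<open>
  This is \<open>w'/w = 2V/W\<close>. With \<open>W = (\<Prod>k\<le>M. (x - Z k))\<close>, the partial fraction sum determines \<open>V\<close> as a
  polynomial of degree less than \<open>M + 1\<close>.
\<close>

definition log_deriv :: "nat \<Rightarrow> (nat \<Rightarrow> complex) \<Rightarrow> (nat \<Rightarrow> complex) \<Rightarrow> complex \<Rightarrow> complex" where
  "log_deriv M Z \<rho> z = (\<Sum>k\<le>M. \<rho> k / (z - Z k))"

text \<open>
  The weight on the circle is differentiated along the circle, away from the singular points. It may
  thus be a branch of \<open>\<Prod>k\<le>M. (\<zeta> - Z k) powr \<rho> k\<close> with a different constant factor on each of the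
  arcs into which the singular points divide the circle. Its values at the singular points are
  immaterial.
\<close>

definition regular_semi_classical ::
    "nat \<Rightarrow> (nat \<Rightarrow> complex) \<Rightarrow> (nat \<Rightarrow> complex) \<Rightarrow> (complex \<Rightarrow> complex) \<Rightarrow> bool" where
  "regular_semi_classical M Z \<rho> w \<longleftrightarrow>
     1 \<le> M \<and> Z 0 = 0 \<and> inj_on Z {..M} \<and> (\<forall>k\<le>M. \<rho> k \<notin> \<nat>) \<and>
     (\<forall>\<zeta> \<in> unit_circle - Z ` {..M}.
        (w has_field_derivative w \<zeta> * log_deriv M Z \<rho> \<zeta>) (at \<zeta> within unit_circle))"

text \<open>
  Off the circle, the symbol \<open>w(z)\<close> in \<open>Y\<^sub>n(z)\<close> stands for a branch of the generally multivalued
  solution of the same equation, with an arbitrary constant factor; the factor multiplies the second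
  column of \<open>Y\<^sub>n\<close> by a constant and does not affect the spectral matrix.
\<close>

definition local_branch ::
    "nat \<Rightarrow> (nat \<Rightarrow> complex) \<Rightarrow> (nat \<Rightarrow> complex) \<Rightarrow> (complex \<Rightarrow> complex) \<Rightarrow> complex \<Rightarrow> bool" where
  "local_branch M Z \<rho> \<omega> z \<longleftrightarrow>
     (\<forall>\<^sub>F u in nhds z. \<omega> u \<noteq> 0 \<and> (\<omega> has_field_derivative \<omega> u * log_deriv M Z \<rho> u) (at u))"

definition mat2 :: "complex \<Rightarrow> complex \<Rightarrow> complex \<Rightarrow> complex \<Rightarrow> complex ^ 2 ^ 2" where
  "mat2 a b c d = vector [vector [a, b], vector [c, d]]"

definition mderiv :: "(complex \<Rightarrow> complex ^ 2 ^ 2) \<Rightarrow> complex \<Rightarrow> complex ^ 2 ^ 2" where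
  "mderiv F z = (\<chi> i k. deriv (\<lambda>u. F u $ i $ k) z)"

definition Y_mat ::
    "(complex \<Rightarrow> complex) \<Rightarrow> (complex \<Rightarrow> complex) \<Rightarrow> (nat \<Rightarrow> complex poly) \<Rightarrow> (nat \<Rightarrow> complex poly)
     \<Rightarrow> nat \<Rightarrow> complex \<Rightarrow> complex ^ 2 ^ 2" where
  "Y_mat w \<omega> \<phi> \<phi>b n z =
     mat2 (poly (\<phi> n) z)     (xi w \<phi> n z / \<omega> z)
          (phi_star \<phi>b n z)  (- xi_star w \<phi>b n z / \<omega> z)"

text \<open>
  \<open>Y\<^sub>n\<close> is invertible off the circle and the singular points, so that its differential equation
  determines \<open>A\<close> there. On the circle \<open>Y\<^sub>n\<close> is not defined and \<open>A\<close> is left unconstrained.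
\<close>

definition spectral_matrix ::
    "nat \<Rightarrow> (nat \<Rightarrow> complex) \<Rightarrow> (nat \<Rightarrow> complex) \<Rightarrow> (complex \<Rightarrow> complex)
     \<Rightarrow> (nat \<Rightarrow> complex poly) \<Rightarrow> (nat \<Rightarrow> complex poly) \<Rightarrow> nat
     \<Rightarrow> (complex \<Rightarrow> complex ^ 2 ^ 2) \<Rightarrow> bool" where
  "spectral_matrix M Z \<rho> w \<phi> \<phi>b n A \<longleftrightarrow>
     (\<forall>z \<omega>. z \<notin> unit_circle \<and> z \<notin> Z ` {..M} \<and> local_branch M Z \<rho> \<omega> z
        \<longrightarrow> mderiv (Y_mat w \<omega> \<phi> \<phi>b n) z = A z ** Y_mat w \<omega> \<phi> \<phi>b n z)"

section \<open>Schlesinger matrices\<close>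

text \<open>
  The argument \<open>s\<close> is the singular point whose exponent is shifted, \<open>\<phi>p\<close> and \<open>\<phi>m\<close> belong to the
  weights \<open>(\<zeta> - s) * w \<zeta>\<close> and \<open>w \<zeta> / (\<zeta> - s)\<close>.
\<close>

definition R_plus ::
    "(nat \<Rightarrow> complex poly) \<Rightarrow> (nat \<Rightarrow> complex poly) \<Rightarrow> (nat \<Rightarrow> complex poly)
     \<Rightarrow> complex \<Rightarrow> nat \<Rightarrow> complex \<Rightarrow> complex ^ 2 ^ 2" where
  "R_plus \<phi> \<phi>b \<phi>p s n z =
     (let c = 1 / (z - s) * (\<kappa> \<phi>p n / \<kappa> \<phi> n) in
      mat2 (c * (z - (\<kappa> \<phi> n * poly (\<phi> (n + 1)) s) / (\<kappa> \<phi> (n + 1) * poly (\<phi> n) s)))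
           (c * (poly (\<phi> (n + 1)) 0 / \<kappa> \<phi> (n + 1)))
           (c * (phi_star \<phi>b n s / poly (\<phi> n) s * z))
           (c * (- s)))"

text \<open>Meaningful for \<open>n \<ge> 1\<close> only.\<close>

definition R_minus ::
    "(complex \<Rightarrow> complex) \<Rightarrow> (nat \<Rightarrow> complex poly) \<Rightarrow> (nat \<Rightarrow> complex poly) \<Rightarrow> (nat \<Rightarrow> complex poly)
     \<Rightarrow> complex \<Rightarrow> nat \<Rightarrow> complex \<Rightarrow> complex ^ 2 ^ 2" where
  "R_minus w \<phi> \<phi>b \<phi>m s n z =
     (let c = \<kappa> \<phi>m n / \<kappa> \<phi> n;
          x = value_at (xi w \<phi> n) s;
          xs = value_at (xi_star w \<phi>b n) s;
          d = \<kappa> \<phi> (n - 1) * value_at (xi_star w \<phi>b (n - 1)) s in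
      mat2 (c * (\<kappa> \<phi> n * xs / d))
           (c * (\<kappa> \<phi> n * x / d))
           (c * (poly (\<phi>b n) 0 * xs / d * (z / s)))
           (c * (1 - \<kappa> \<phi> n * xs / d * (z / s))))"

end

theory Submission
  imports Defs
begin

text \<open>
  With \<open>T p z = \<integral> w(\<zeta>) p(\<zeta>) / (\<zeta> - z)\<close> one has \<open>\<xi>\<^sub>n(z) = 2 T(\<zeta> \<phi>\<^sub>n)(z)\<close> and \<open>\<xi>\<^sup>*\<^sub>n(z) = - 2 z T(\<phi>\<^sup>*\<^sub>n)(z)\<close>
  for all \<open>n \<ge> 0\<close>, so that both columns of \<open>Y\<^sub>n\<close> obey the same recurrences up to boundary moments, which
  cancel. The polynomials of the shifted weight are identified by their degree, one coefficient and
  their orthogonality; applying \<open>T\<close> to these identities gives \<open>Y\<^sub>n\<^sup>\<plusminus> = R\<^sub>n\<^sup>\<plusminus> Y\<^sub>n\<close> off the circle. As \<open>det Y\<^sub>n\<close>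
  does not vanish, differentiating and cancelling \<open>Y\<^sub>n\<close> proves the claim there, and on the circle
  it follows by continuity along a ray.
\<close>

section \<open>Means over the unit circle\<close>

text \<open>The weight on the circle is merely an integrable function, so identities between the
  associated functions have to be read off from identities between kernels. \<open>T\<close> is
  preferred to the kernel (\<zeta> + z) / (\<zeta> - z) because multiplying the polynomial by
  \<zeta>, or the weight by \<zeta> - s, multiplies \<open>T\<close> by z, or by z - s, up to a
  moment free of z. The separate definitions of \<xi>_0 and \<xi>*_0 are exactly what extends both
  formulas to n = 0. The two signs need different mechanisms. For +, a combination of known
  polynomials is made to vanish at s, divided by \<zeta> - s, and recognised as orthogonal for the
  raised weight. For -, there is nothing to divide: \<xi>_n(s) and \<xi>*_n(s), limits when s lies
  on the circle, turn out to be moments of the lowered weight, and since all relevant moments are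
  fixed multiples of these two, a single linear relation annihilates them together. This is how the
  values at s enter R^-.\<close>

lemma circ_mean_integral: "circ_mean f = integral {0..1} (\<lambda>t. f (circlepath 0 1 t))"
proof -
  have "f (circlepath 0 1 t) / (2 * of_real pi * \<i> * circlepath 0 1 t)
          * vector_derivative (circlepath 0 1) (at t) = f (circlepath 0 1 t)" for t
    by (simp add: vector_derivative_circlepath) (simp add: circlepath)
  then show ?thesis
    by (simp add: circ_mean_def contour_integral_integral)
qed

lemma circlepath_in_circle: "circlepath 0 1 t \<in> unit_circle"
  by (simp add: circlepath)

lemma circ_mean_cong:
  assumes "\<And>\<zeta>. \<zeta> \<in> unit_circle \<Longrightarrow> f \<zeta> = g \<zeta>"
  shows "circ_mean f = circ_mean g"
  unfolding circ_mean_integral by (rule integral_cong) (rule assms [OF circlepath_in_circle])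

text \<open>The circle is a simple loop, so besides one preimage only the two endpoints of the
  parameter interval can occur.\<close>

lemma finite_circlepath_vimage: "finite {t \<in> {0..1}. circlepath 0 1 t = s}" (is "finite ?N")
proof (cases "?N = {}")
  case False
  then obtain t0 where t0: "t0 \<in> {0..1}" "circlepath 0 1 t0 = s"
    by blast
  have "loop_free (circlepath 0 1)"
    using simple_path_circlepath [of 0 1] by (simp add: simple_path_def)
  then have "t = t0 \<or> t = 0 \<or> t = 1" if "t \<in> ?N" for t
    using that t0 unfolding loop_free_def by blast
  then have "?N \<subseteq> {t0, 0, 1}"
    by blast
  then show ?thesis
    by (rule finite_subset) simp
qed (simp only: finite.emptyI)

text \<open>Meant for cancelling \<zeta> - s against 1 / (\<zeta> - s): as \<open>x / 0 = 0\<close>,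
  such identities may fail at \<zeta> = s itself.\<close>

lemma circ_mean_cong_except:
  assumes "\<And>\<zeta>. \<zeta> \<in> unit_circle \<Longrightarrow> \<zeta> \<noteq> s \<Longrightarrow> f \<zeta> = g \<zeta>"
  shows "circ_mean f = circ_mean g"
  unfolding circ_mean_integral
  by (rule integral_spike [OF negligible_finite [OF finite_circlepath_vimage [of s]]])
     (use assms circlepath_in_circle in auto)

lemma continuous_on_circlepath: "continuous_on {0..1} (circlepath z r)"
  using path_circlepath [of z r] by (simp add: path_def)

lemma kernel_absolutely_integrable:
  assumes "moments_exist w" "continuous_on unit_circle K"
  shows "(\<lambda>t. w (circlepath 0 1 t) * K (circlepath 0 1 t)) absolutely_integrable_on {0..1}"
proof -
  have cont: "continuous_on {0..1} (\<lambda>t. K (circlepath 0 1 t))"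
    by (rule continuous_on_compose2 [OF assms(2) continuous_on_circlepath])
       (use circlepath_in_circle in blast)
  have "(\<lambda>t. K (circlepath 0 1 t) * w (circlepath 0 1 t)) absolutely_integrable_on {0..1}"
  proof (rule absolutely_integrable_bounded_measurable_product [OF bilinear_times])
    show "(\<lambda>t. K (circlepath 0 1 t)) \<in> borel_measurable (lebesgue_on {0..1})"
      by (rule continuous_imp_measurable_on_sets_lebesgue [OF cont]) simp
    show "bounded ((\<lambda>t. K (circlepath 0 1 t)) ` {0..1})"
      by (rule compact_imp_bounded [OF compact_continuous_image [OF cont]]) simp
  qed (use assms in \<open>auto simp: moments_exist_def\<close>)
  then show ?thesis
    by (simp add: mult.commute)
qed

text \<open>The weight is kept apart from the kernel \<open>K\<close>, whose continuity on the
  circle then secures integrability of the product.\<close>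

definition wmean :: "(complex \<Rightarrow> complex) \<Rightarrow> (complex \<Rightarrow> complex) \<Rightarrow> complex" where
  "wmean w K = circ_mean (\<lambda>\<zeta>. w \<zeta> * K \<zeta>)"

lemma wmean_cong:
  assumes "\<And>\<zeta>. \<zeta> \<in> unit_circle \<Longrightarrow> K \<zeta> = L \<zeta>"
  shows "wmean w K = wmean w L"
  unfolding wmean_def by (rule circ_mean_cong) (simp add: assms)

lemma wmean_add:
  assumes "moments_exist w" "continuous_on unit_circle K" "continuous_on unit_circle L"
  shows "wmean w (\<lambda>\<zeta>. K \<zeta> + L \<zeta>) = wmean w K + wmean w L"
  using kernel_absolutely_integrable [OF assms(1,2)] kernel_absolutely_integrable [OF assms(1,3)]
  by (simp add: wmean_def circ_mean_integral distrib_left integral_add absolutely_integrable_on_def)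

lemma wmean_cmult: "wmean w (\<lambda>\<zeta>. c * K \<zeta>) = c * wmean w K"
  using integral_mult_right [of "{0..1}" c "\<lambda>t. w (circlepath 0 1 t) * K (circlepath 0 1 t)"]
  by (simp add: wmean_def circ_mean_integral mult.left_commute)

lemma wmean_diff:
  assumes "moments_exist w" "continuous_on unit_circle K" "continuous_on unit_circle L"
  shows "wmean w (\<lambda>\<zeta>. K \<zeta> - L \<zeta>) = wmean w K - wmean w L"
  using wmean_add [OF assms(1,2), of "\<lambda>\<zeta>. - 1 * L \<zeta>"] wmean_cmult [of w "- 1" L] assms(3)
  by (simp add: continuous_on_minus)

text \<open>
  The exceptional point \<open>s\<close> serves the radial limit at a singular point \<open>s\<close> on the circle, where
  \<open>(\<zeta> - s) / (\<zeta> - r s)\<close> does not tend to 1 at \<open>\<zeta> = s\<close>.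
\<close>

lemma tendsto_wmean:
  fixes K :: "'a::first_countable_topology \<Rightarrow> complex \<Rightarrow> complex"
  assumes w: "moments_exist w"
    and cont: "\<And>x. x \<in> S \<Longrightarrow> continuous_on unit_circle (K x)"
    and bound: "\<And>x \<zeta>. x \<in> S \<Longrightarrow> \<zeta> \<in> unit_circle \<Longrightarrow> norm (K x \<zeta>) \<le> C"
    and lim: "\<And>\<zeta>. \<zeta> \<in> unit_circle \<Longrightarrow> \<zeta> \<noteq> s \<Longrightarrow> ((\<lambda>x. K x \<zeta>) \<longlongrightarrow> L \<zeta>) (at a within S)"
  shows "((\<lambda>x. wmean w (K x)) \<longlongrightarrow> wmean w L) (at a within S)"
proof (subst tendsto_at_iff_sequentially, intro allI impI)
  fix X :: "nat \<Rightarrow> 'a" assume X: "\<forall>i. X i \<in> S - {a}" "X \<longlonglongrightarrow> a"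
  let ?c = "circlepath 0 1"
  \<comment> \<open>Deleting the value of the weight at \<open>s\<close> changes no mean and gives
    convergence at every parameter, as dominated convergence is stated for.\<close>
  define v where "v \<zeta> = (if \<zeta> = s then 0 else w \<zeta>)" for \<zeta>
  have vw: "wmean w f = wmean v f" for f
    unfolding wmean_def by (rule circ_mean_cong_except [of s]) (simp add: v_def)
  have "norm (K (X 0) 1) \<le> C"
    by (rule bound) (use X in auto)
  then have C: "0 \<le> C"
    by (rule order_trans [OF norm_ge_zero])
  have v: "(\<lambda>t. v (?c t) * f (?c t)) absolutely_integrable_on {0..1}"
    if "continuous_on unit_circle f" for f
    by (rule absolutely_integrable_spike [OF kernel_absolutely_integrable [OF w that]
          negligible_finite [OF finite_circlepath_vimage [of s]]]) (auto simp: v_def)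
  have "(\<lambda>k. integral {0..1} (\<lambda>t. v (?c t) * K (X k) (?c t))) \<longlonglongrightarrow> integral {0..1} (\<lambda>t. v (?c t) * L (?c t))"
  proof (rule dominated_convergence)
    show "(\<lambda>t. v (?c t) * K (X k) (?c t)) integrable_on {0..1}" for k
      using v [OF cont [of "X k"]] X(1) by (simp add: absolutely_integrable_on_def)
    show "(\<lambda>t. norm (w (?c t)) * C) integrable_on {0..1}"
      using w by (simp add: moments_exist_def absolutely_integrable_on_def integrable_on_mult_left)
    show "norm (v (?c t) * K (X k) (?c t)) \<le> norm (w (?c t)) * C" for k t
      using bound [of "X k" "?c t"] X(1) C circlepath_in_circle [of t]
      by (auto simp: v_def norm_mult intro!: mult_left_mono)
    show "(\<lambda>k. v (?c t) * K (X k) (?c t)) \<longlonglongrightarrow> v (?c t) * L (?c t)" for t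
      using lim [OF circlepath_in_circle [of t]] X
      by (auto simp: v_def tendsto_at_iff_sequentially o_def intro!: tendsto_mult_left)
  qed
  then show "((\<lambda>x. wmean w (K x)) \<circ> X) \<longlonglongrightarrow> wmean w L"
    by (simp add: vw o_def) (simp add: wmean_def circ_mean_integral)
qed

section \<open>The pairing and the Cauchy transform\<close>

text \<open>The Toeplitz form of the weight, bilinear rather than sesquilinear: \<zeta>^i against
  \<zeta>^j gives the moment of index j - i.\<close>

definition pairing :: "(complex \<Rightarrow> complex) \<Rightarrow> complex poly \<Rightarrow> complex poly \<Rightarrow> complex" where
  "pairing w p q = wmean w (\<lambda>\<zeta>. poly p \<zeta> * poly q (1 / \<zeta>))"

definition cauchy_transform :: "(complex \<Rightarrow> complex) \<Rightarrow> complex poly \<Rightarrow> complex \<Rightarrow> complex" where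
  "cauchy_transform w p z = wmean w (\<lambda>\<zeta>. poly p \<zeta> / (\<zeta> - z))"

lemma circle_nonzero: "\<zeta> \<in> unit_circle \<Longrightarrow> \<zeta> \<noteq> 0"
  by auto

lemma continuous_on_pairing_kernel: "continuous_on unit_circle (\<lambda>\<zeta>. poly p \<zeta> * poly q (1 / \<zeta>))"
  by (intro continuous_intros) auto

lemma continuous_on_cauchy_kernel:
  "z \<notin> unit_circle \<Longrightarrow> continuous_on unit_circle (\<lambda>\<zeta>. poly p \<zeta> / (\<zeta> - z))"
  by (intro continuous_intros) auto

lemma pairing_add_left:
  "moments_exist w \<Longrightarrow> pairing w (p + p') q = pairing w p q + pairing w p' q"
  by (simp add: pairing_def distrib_right wmean_add continuous_on_pairing_kernel)

lemma pairing_diff_left: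
  "moments_exist w \<Longrightarrow> pairing w (p - p') q = pairing w p q - pairing w p' q"
  by (simp add: pairing_def left_diff_distrib wmean_diff continuous_on_pairing_kernel)

lemma pairing_add_right:
  "moments_exist w \<Longrightarrow> pairing w p (q + q') = pairing w p q + pairing w p q'"
  by (simp add: pairing_def distrib_left wmean_add continuous_on_pairing_kernel)

lemma pairing_smult_left: "pairing w (smult c p) q = c * pairing w p q"
  by (simp add: pairing_def wmean_cmult mult.assoc)

lemma pairing_smult_right: "pairing w p (smult c q) = c * pairing w p q"
  by (simp add: pairing_def wmean_cmult mult.left_commute)

text \<open>The Toeplitz property: on the circle the factors \<zeta> and 1 / \<zeta> cancel.\<close>

lemma pairing_pCons: "pairing w (pCons 0 p) (pCons 0 q) = pairing w p q"
  unfolding pairing_def by (rule wmean_cong) auto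

lemma cauchy_transform_add:
  "moments_exist w \<Longrightarrow> z \<notin> unit_circle \<Longrightarrow>
     cauchy_transform w (p + q) z = cauchy_transform w p z + cauchy_transform w q z"
  by (simp add: cauchy_transform_def add_divide_distrib wmean_add continuous_on_cauchy_kernel)

lemma cauchy_transform_diff:
  "moments_exist w \<Longrightarrow> z \<notin> unit_circle \<Longrightarrow>
     cauchy_transform w (p - q) z = cauchy_transform w p z - cauchy_transform w q z"
  by (simp add: cauchy_transform_def diff_divide_distrib wmean_diff continuous_on_cauchy_kernel)

lemma cauchy_transform_smult: "cauchy_transform w (smult c p) z = c * cauchy_transform w p z"
  unfolding cauchy_transform_def by (simp flip: wmean_cmult)

text \<open>From \<zeta> / (\<zeta> - z) = 1 + z / (\<zeta> - z); the summand 1 is the origin of all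
  boundary moments.\<close>

lemma cauchy_transform_pCons:
  assumes "moments_exist w" "z \<notin> unit_circle"
  shows "cauchy_transform w (pCons 0 p) z = pairing w p 1 + z * cauchy_transform w p z"
proof -
  have "cauchy_transform w (pCons 0 p) z
      = wmean w (\<lambda>\<zeta>. poly p \<zeta> * poly 1 (1 / \<zeta>) + z * (poly p \<zeta> / (\<zeta> - z)))"
    unfolding cauchy_transform_def
  proof (rule wmean_cong)
    fix \<zeta> :: complex assume "\<zeta> \<in> unit_circle"
    then have "\<zeta> - z \<noteq> 0"
      using assms(2) by auto
    then show "poly (pCons 0 p) \<zeta> / (\<zeta> - z) = poly p \<zeta> * poly 1 (1 / \<zeta>) + z * (poly p \<zeta> / (\<zeta> - z))"
      by (simp add: field_simps)
  qed
  also have "\<dots> = pairing w p 1 + z * cauchy_transform w p z"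
    using wmean_add [OF assms(1) continuous_on_pairing_kernel [of p 1]
        continuous_on_mult_left [OF continuous_on_cauchy_kernel [OF assms(2), of p], of z]]
    by (simp only: pairing_def cauchy_transform_def wmean_cmult)
  finally show ?thesis .
qed

text \<open>The difference quotient between u and z has the kernel p(\<zeta>) / ((\<zeta> -
  u)(\<zeta> - z)), so the derivative is a dominated limit of means.\<close>

lemma cauchy_transform_holomorphic:
  assumes w: "moments_exist w"
  shows "cauchy_transform w p holomorphic_on - unit_circle"
proof -
  have "(cauchy_transform w p has_field_derivative wmean w (\<lambda>\<zeta>. poly p \<zeta> / (\<zeta> - z)\<^sup>2)) (at z)"
    if z: "z \<notin> unit_circle" for z
  proof -
    have "open (- unit_circle)"
      by (simp add: open_Compl)
    \<comment> \<open>The doubled radius keeps all of \<open>ball z e\<close> at distance at least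
      \<open>e\<close> from the circle, which bounds the kernels uniformly.\<close>
    then obtain e where e: "e > 0" "ball z (2 * e) \<subseteq> - unit_circle"
      using z by (metis (no_types, lifting) ComplI mult.commute open_contains_ball_eq field_sum_of_halves
        mult_2 half_gt_zero)
    have off: "norm (\<zeta> - u) \<ge> e" if "\<zeta> \<in> unit_circle" "u \<in> ball z e" for \<zeta> u
    proof (rule ccontr)
      assume "\<not> e \<le> norm (\<zeta> - u)"
      then have "dist z \<zeta> < 2 * e"
        using dist_triangle [of z \<zeta> u] that by (simp add: dist_norm norm_minus_commute)
      then show False
        using e that(1) by (auto simp: subset_iff)
    qed
    have nz: "\<zeta> \<noteq> u" if "\<zeta> \<in> unit_circle" "u \<in> ball z e" for \<zeta> u
      using off [OF that] e(1) by auto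
    obtain C where C: "\<And>\<zeta>. \<zeta> \<in> unit_circle \<Longrightarrow> norm (poly p \<zeta>) \<le> C"
      using compact_imp_bounded [OF compact_continuous_image [of unit_circle "poly p"]]
      by (force simp: bounded_iff intro: continuous_intros)
    have "((\<lambda>u. wmean w (\<lambda>\<zeta>. poly p \<zeta> / ((\<zeta> - u) * (\<zeta> - z)))) \<longlongrightarrow>
        wmean w (\<lambda>\<zeta>. poly p \<zeta> / (\<zeta> - z)\<^sup>2)) (at z within ball z e)"
    proof (rule tendsto_wmean [OF w, where C = "C / (e * e)"])
      fix u assume u: "u \<in> ball z e"
      then show "continuous_on unit_circle (\<lambda>\<zeta>. poly p \<zeta> / ((\<zeta> - u) * (\<zeta> - z)))"
        using nz e(1) by (intro continuous_intros) auto
      fix \<zeta> :: complex assume \<zeta>: "\<zeta> \<in> unit_circle"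
      show "norm (poly p \<zeta> / ((\<zeta> - u) * (\<zeta> - z))) \<le> C / (e * e)"
        using C [OF \<zeta>] off [OF \<zeta> u] off [OF \<zeta>, of z] e(1)
        by (auto simp: norm_divide norm_mult intro!: frac_le mult_mono order_trans [OF norm_ge_zero C [OF \<zeta>]])
    next
      fix \<zeta> :: complex assume \<zeta>: "\<zeta> \<in> unit_circle"
      then have "\<zeta> - z \<noteq> 0"
        using z by auto
      then show "((\<lambda>u. poly p \<zeta> / ((\<zeta> - u) * (\<zeta> - z))) \<longlongrightarrow> poly p \<zeta> / (\<zeta> - z)\<^sup>2) (at z within ball z e)"
        unfolding power2_eq_square by (intro tendsto_intros) auto
    qed
    then have lim: "((\<lambda>u. wmean w (\<lambda>\<zeta>. poly p \<zeta> / ((\<zeta> - u) * (\<zeta> - z)))) \<longlongrightarrow>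
        wmean w (\<lambda>\<zeta>. poly p \<zeta> / (\<zeta> - z)\<^sup>2)) (at z)"
      using e(1) by (subst (asm) at_within_open) auto
    have "eventually (\<lambda>u. u \<in> ball z e) (at z)"
      using e(1) by (intro eventually_at_in_open') auto
    then have ev: "eventually (\<lambda>u. wmean w (\<lambda>\<zeta>. poly p \<zeta> / ((\<zeta> - u) * (\<zeta> - z)))
        = (cauchy_transform w p u - cauchy_transform w p z) / (u - z)) (at z)"
      using eventually_neq_at_within [of z z UNIV]
    proof eventually_elim
      case (elim u)
      have u: "u \<notin> unit_circle"
        using nz [OF _ elim(1)] by blast
      have "cauchy_transform w p u - cauchy_transform w p z
          = wmean w (\<lambda>\<zeta>. poly p \<zeta> / (\<zeta> - u) - poly p \<zeta> / (\<zeta> - z))"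
        unfolding cauchy_transform_def
        by (rule wmean_diff [symmetric, OF w]) (intro continuous_on_cauchy_kernel u z)+
      also have "\<dots> = wmean w (\<lambda>\<zeta>. (u - z) * (poly p \<zeta> / ((\<zeta> - u) * (\<zeta> - z))))"
      proof (rule wmean_cong)
        fix \<zeta> :: complex assume \<zeta>: "\<zeta> \<in> unit_circle"
        then have "\<zeta> - z \<noteq> 0" "\<zeta> - u \<noteq> 0"
          using z u by auto
        then show "poly p \<zeta> / (\<zeta> - u) - poly p \<zeta> / (\<zeta> - z) = (u - z) * (poly p \<zeta> / ((\<zeta> - u) * (\<zeta> - z)))"
          by (simp add: divide_simps) (simp add: algebra_simps)
      qed
      also have "\<dots> = (u - z) * wmean w (\<lambda>\<zeta>. poly p \<zeta> / ((\<zeta> - u) * (\<zeta> - z)))"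
        by (rule wmean_cmult)
      finally have eq: "cauchy_transform w p u - cauchy_transform w p z = \<dots>" .
      show ?case
        unfolding eq using elim(2) by (subst nonzero_mult_div_cancel_left) simp_all
    qed
    show ?thesis
      unfolding has_field_derivative_iff by (rule Lim_transform_eventually [OF lim ev])
  qed
  then show ?thesis
    unfolding holomorphic_on_def field_differentiable_def
    by (metis ComplD has_field_derivative_at_within)
qed

lemma degree_less_if_coeff_0:
  assumes "degree p \<le> m" "coeff p m = 0"
  shows "p = 0 \<or> degree p < m"
  using assms by (metis le_neq_implies_less leading_coeff_0_iff)

text \<open>Induction on the degree, removing the leading term by the member of \<open>P\<close> of
  that degree. \<open>L\<close> is only additive, so the vanishing is required for all scalar
  multiples of \<open>P m\<close>.\<close>

lemma linear_vanishes_below: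
  fixes L :: "'a::field poly \<Rightarrow> 'b::ab_group_add"
  assumes add: "\<And>p q. L (p + q) = L p + L q"
    and basis: "\<And>c m. m < n \<Longrightarrow> L (smult c (P m)) = 0"
    and deg: "\<And>m. degree (P m) = m" and nz: "\<And>m. P m \<noteq> 0"
    and p: "degree p < n"
  shows "L p = 0"
  using p
proof (induction "degree p" arbitrary: p rule: less_induct)
  case less
  have L0: "L 0 = 0"
    using add [of 0 0] by simp
  define m where "m = degree p"
  have lead: "coeff (P m) m \<noteq> 0"
    using leading_coeff_neq_0 [OF nz [of m]] unfolding deg .
  define c where "c = coeff p m / coeff (P m) m"
  define q where "q = p - smult c (P m)"
  have "degree q \<le> m"
    unfolding q_def by (intro degree_diff_le) (auto simp: m_def deg)
  moreover have "coeff q m = 0"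
    using lead by (simp add: q_def c_def)
  ultimately have "q = 0 \<or> degree q < m"
    by (rule degree_less_if_coeff_0)
  then have Lq: "L q = 0"
    using L0 less.hyps [of q] less.prems by (auto simp: m_def)
  have "p = q + smult c (P m)"
    by (simp add: q_def)
  then have "L p = L q + L (smult c (P m))"
    using add by metis
  then show ?case
    using basis [of m c] less.prems Lq by (simp add: m_def)
qed

section \<open>Szego recurrences and the associated functions\<close>

locale biorth =
  fixes w :: "complex \<Rightarrow> complex" and \<phi> \<phi>b :: "nat \<Rightarrow> complex poly"
  assumes admissible: "admissible w \<phi> \<phi>b"
begin

abbreviation B where "B \<equiv> pairing w"
abbreviation T where "T \<equiv> cauchy_transform w"
abbreviation \<phi>s where "\<phi>s n \<equiv> reflect_poly (\<phi>b n)"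
abbreviation k where "k \<equiv> \<kappa> \<phi>"

lemma w: "moments_exist w"
  using admissible by (simp add: admissible_def)

lemma degree_phi [simp]: "degree (\<phi> n) = n" and degree_phib [simp]: "degree (\<phi>b n) = n"
  using admissible by (simp_all add: admissible_def biorth_system_def)

lemma lead_coeff_phi: "coeff (\<phi> n) n = k n"
  by (simp add: \<kappa>_def)

lemma lead_coeff_phib: "coeff (\<phi>b n) n = k n"
proof -
  have "lead_coeff (\<phi> n) = lead_coeff (\<phi>b n)"
    using admissible unfolding admissible_def biorth_system_def by blast
  then show ?thesis
    by (simp add: \<kappa>_def)
qed

lemma biorth: "B (\<phi> m) (\<phi>b n) = (if m = n then 1 else 0)"
  using admissible by (simp add: admissible_def biorth_system_def pairing_def wmean_def mult.assoc)

lemma \<kappa>_nonzero [simp]: "k n \<noteq> 0"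
proof
  assume "k n = 0"
  then have "\<phi> n = smult 0 (\<phi> n)"
    by (metis \<kappa>_def leading_coeff_0_iff smult_0_left)
  then show False
    using biorth [of n n] pairing_smult_left [of w 0 "\<phi> n" "\<phi>b n"] by simp
qed

lemma phi_nonzero [simp]: "\<phi> n \<noteq> 0" and phib_nonzero [simp]: "\<phi>b n \<noteq> 0"
  using \<kappa>_nonzero [of n] lead_coeff_phi [of n] lead_coeff_phib [of n] by (metis coeff_0)+

lemma pairing_phi_eq_0: "degree q < n \<Longrightarrow> B (\<phi> n) q = 0"
  by (rule linear_vanishes_below [where L = "B (\<phi> n)" and P = \<phi>b and n = n])
     (simp_all add: pairing_add_right [OF w] pairing_smult_right biorth)

lemma pairing_phib_eq_0: "degree p < n \<Longrightarrow> B p (\<phi>b n) = 0"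
  by (rule linear_vanishes_below [where L = "\<lambda>p. B p (\<phi>b n)" and P = \<phi> and n = n])
     (simp_all add: pairing_add_left [OF w] pairing_smult_left biorth)

lemma pairing_phib:
  assumes "degree p \<le> n"
  shows "B p (\<phi>b n) = coeff p n / k n"
proof -
  define q where "q = p - smult (coeff p n / k n) (\<phi> n)"
  have "degree q \<le> n"
    unfolding q_def using assms by (intro degree_diff_le) auto
  moreover have "coeff q n = 0"
    by (simp add: q_def lead_coeff_phi)
  ultimately have "q = 0 \<or> degree q < n"
    by (rule degree_less_if_coeff_0)
  then have "B q (\<phi>b n) = 0"
    using pairing_phib_eq_0 pairing_smult_left [of w 0 0 "\<phi>b n"] by auto
  then show ?thesis
    by (simp add: q_def pairing_diff_left [OF w] pairing_smult_left biorth)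
qed

text \<open>On the circle \<phi>*_n(\<zeta>) \<zeta>^(-j) equals \<zeta>^(n-j) times
  \<open>\<phi>b n\<close> at 1 / \<zeta>, so orthogonality of \<open>\<phi>b n\<close> to lower
  degrees becomes orthogonality of \<phi>*_n to \<zeta>, ..., \<zeta>^n.\<close>

lemma pairing_phis:
  assumes "j \<le> n"
  shows "B (\<phi>s n) (monom 1 j) = (if j = 0 then 1 / k n else 0)"
proof -
  have "B (\<phi>s n) (monom 1 j) = B (monom 1 (n - j)) (\<phi>b n)"
    unfolding pairing_def
  proof (rule wmean_cong)
    fix \<zeta> :: complex assume "\<zeta> \<in> unit_circle"
    then have "\<zeta> \<noteq> 0"
      by (rule circle_nonzero)
    then show "poly (\<phi>s n) \<zeta> * poly (monom 1 j) (1 / \<zeta>) = poly (monom 1 (n - j)) \<zeta> * poly (\<phi>b n) (1 / \<zeta>)"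
      using assms by (simp add: poly_reflect_poly_nz poly_monom power_diff inverse_eq_divide power_divide)
  qed
  also have "\<dots> = (if j = 0 then 1 / k n else 0)"
    using assms by (subst pairing_phib) (auto simp: degree_monom_eq)
  finally show ?thesis .
qed

lemma pairing_phis_1: "B (\<phi>s n) 1 = 1 / k n"
  using pairing_phis [of 0 n] by simp

lemma degree_phis: "degree (\<phi>s n) \<le> n"
  using degree_reflect_poly_le [of "\<phi>b n"] by simp

lemma pairing_all_zero:
  assumes "\<And>j. j \<le> degree q \<Longrightarrow> B g (monom 1 j) = 0"
  shows "B g q = 0"
  by (rule linear_vanishes_below [where L = "B g" and P = "monom 1" and n = "Suc (degree q)"])
     (simp_all add: pairing_add_right [OF w] pairing_smult_right assms degree_monom_eq)

text \<open>Nondegeneracy of the form: a nonzero \<open>g\<close> of degree d < n pairs with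
  \<open>\<phi>b d\<close> to its leading coefficient over \<kappa>_d, yet is orthogonal to
  everything of degree at most d.\<close>

lemma unique_phi:
  assumes "degree g \<le> n" "coeff g n = 0" "\<And>j. j < n \<Longrightarrow> B g (monom 1 j) = 0"
  shows "g = 0"
proof (rule ccontr)
  assume g: "g \<noteq> 0"
  then have "degree g < n"
    using degree_less_if_coeff_0 [OF assms(1,2)] by simp
  then have "B g (\<phi>b (degree g)) = 0"
    by (intro pairing_all_zero [OF assms(3)]) simp
  then show False
    using g pairing_phib [of g "degree g"] by simp
qed

text \<open>Splitting off the factor \<zeta> lowers every test monomial by one, by the Toeplitz
  property, and leads back to \<open>unique_phi\<close>.\<close>

lemma unique_phi_star:
  assumes "degree g \<le> n" "coeff g 0 = 0" "\<And>j. 1 \<le> j \<Longrightarrow> j \<le> n \<Longrightarrow> B g (monom 1 j) = 0"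
  shows "g = 0"
proof -
  obtain h where g: "g = pCons 0 h"
    using assms(2) by (cases g rule: pCons_cases) auto
  have "h = 0"
  proof (rule unique_phi)
    show "degree h \<le> n"
      using assms(1) by (simp add: g split: if_splits)
    show "coeff h n = 0"
      using assms(1) coeff_eq_0 [of h n] by (cases "h = 0") (simp_all add: g)
    show "B h (monom 1 j) = 0" if "j < n" for j
      using assms(3) [of "Suc j"] that by (simp add: g monom_Suc pairing_pCons)
  qed
  then show ?thesis
    by (simp add: g)
qed

lemma pairing_pCons_phi:
  "1 \<le> j \<Longrightarrow> j \<le> n \<Longrightarrow> B (pCons 0 (\<phi> n)) (monom 1 j) = 0"
  by (cases j) (simp_all add: monom_Suc pairing_pCons pairing_phi_eq_0 degree_monom_eq)

lemma pairing_phi: "j < n \<Longrightarrow> B (\<phi> n) (monom 1 j) = 0"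
  by (simp add: pairing_phi_eq_0 degree_monom_eq)

lemmas pairing_simps =
  pairing_diff_left [OF w] pairing_add_left [OF w] pairing_smult_left pairing_phi pairing_phis
  pairing_pCons_phi

text \<open>All three polynomials are orthogonal to \<zeta>, ..., \<zeta>^n. The coefficients are
  chosen so that the top and the constant term of the difference cancel, whereupon
  \<open>unique_phi_star\<close> applies.\<close>

lemma szego_recurrence:
  "smult (k n) (\<phi> (Suc n)) = smult (k (Suc n)) (pCons 0 (\<phi> n)) + smult (coeff (\<phi> (Suc n)) 0) (\<phi>s n)"
proof -
  define g where "g = smult (k n) (\<phi> (Suc n)) -
    (smult (k (Suc n)) (pCons 0 (\<phi> n)) + smult (coeff (\<phi> (Suc n)) 0) (\<phi>s n))"
  have "degree g \<le> Suc n"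
    unfolding g_def
    by (intro degree_diff_le degree_add_le order_trans [OF degree_smult_le])
       (auto simp: degree_pCons_eq intro: le_SucI [OF degree_phis])
  moreover have "coeff g (Suc n) = 0"
    by (simp add: g_def lead_coeff_phi coeff_reflect_poly)
  ultimately have "degree g \<le> n"
    using degree_less_if_coeff_0 [of g "Suc n"] by auto
  moreover have "coeff g 0 = 0"
    by (simp add: g_def lead_coeff_phib)
  moreover have "B g (monom 1 j) = 0" if "1 \<le> j" "j \<le> n" for j
    using that by (simp add: g_def pairing_simps del: smult_pCons)
  ultimately have "g = 0"
    by (rule unique_phi_star)
  then show ?thesis
    by (simp add: g_def)
qed

lemma szego_recurrence_star:
  "smult (k n) (\<phi>s (Suc n)) = smult (coeff (\<phi>b (Suc n)) 0) (pCons 0 (\<phi> n)) + smult (k (Suc n)) (\<phi>s n)"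
proof -
  define g where "g = smult (k n) (\<phi>s (Suc n)) -
    (smult (coeff (\<phi>b (Suc n)) 0) (pCons 0 (\<phi> n)) + smult (k (Suc n)) (\<phi>s n))"
  have "degree g \<le> Suc n"
    unfolding g_def
    by (intro degree_diff_le degree_add_le order_trans [OF degree_smult_le])
       (auto simp: degree_pCons_eq intro: le_SucI [OF degree_phis] degree_phis)
  moreover have "coeff g (Suc n) = 0"
    by (simp add: g_def lead_coeff_phi coeff_reflect_poly)
  ultimately have "degree g \<le> n"
    using degree_less_if_coeff_0 [of g "Suc n"] by auto
  moreover have "coeff g 0 = 0"
    by (simp add: g_def lead_coeff_phib)
  moreover have "B g (monom 1 j) = 0" if "1 \<le> j" "j \<le> n" for j
    using that by (simp add: g_def pairing_simps del: smult_pCons)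
  ultimately have "g = 0"
    by (rule unique_phi_star)
  then show ?thesis
    by (simp add: g_def)
qed

text \<open>The top terms on the right cancel, so the result has degree at most n and must be a
  multiple of \<phi>*_n. The factor is found by pairing with 1, where \<phi>_{n+1} drops out;
  comparing constant terms would instead express it through \<kappa>_{n+1} and the values at
  0.\<close>

lemma inverse_szego_recurrence_star:
  "smult (k n) (\<phi>s n) = smult (k (Suc n)) (\<phi>s (Suc n)) - smult (coeff (\<phi>b (Suc n)) 0) (\<phi> (Suc n))"
proof -
  define f where "f = smult (k (Suc n)) (\<phi>s (Suc n)) - smult (coeff (\<phi>b (Suc n)) 0) (\<phi> (Suc n))"
  define c where "c = coeff f 0 / k n"
  define g where "g = f - smult c (\<phi>s n)"
  have "degree f \<le> Suc n"
    unfolding f_def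
    by (intro degree_diff_le order_trans [OF degree_smult_le]) (auto intro: degree_phis)
  moreover have "coeff f (Suc n) = 0"
    by (simp add: f_def lead_coeff_phi coeff_reflect_poly)
  ultimately have "degree f \<le> n"
    using degree_less_if_coeff_0 [of f "Suc n"] by auto
  then have "degree g \<le> n"
    unfolding g_def by (intro degree_diff_le order_trans [OF degree_smult_le] degree_phis)
  moreover have "coeff g 0 = 0"
    by (simp add: g_def c_def lead_coeff_phib)
  moreover have "B g (monom 1 j) = 0" if "1 \<le> j" "j \<le> n" for j
    using that by (simp add: g_def f_def pairing_simps)
  ultimately have "g = 0"
    by (rule unique_phi_star)
  then have "B f 1 = c * B (\<phi>s n) 1"
    by (simp add: g_def pairing_smult_left)
  moreover have "B f 1 = 1"
    using pairing_phi [of 0 "Suc n"] by (simp add: f_def pairing_simps pairing_phis_1)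
  ultimately have "c = k n"
    by (simp add: pairing_phis_1 field_simps)
  with \<open>g = 0\<close> show ?thesis
    by (simp add: g_def f_def)
qed

text \<open>Since (\<zeta> + z) / (\<zeta> - z) = 2 \<zeta> / (\<zeta> - z) - 1, the two sides
  differ by the mean of \<phi>_n, which vanishes for n > 0 and is the extra term \<kappa>_0 w_0 in
  the definition for n = 0.\<close>

lemma xi_eq:
  assumes "z \<notin> unit_circle"
  shows "xi w \<phi> n z = 2 * T (pCons 0 (\<phi> n)) z"
proof -
  have *: "continuous_on unit_circle (\<lambda>\<zeta>. (\<zeta> + z) / (\<zeta> - z) * poly (\<phi> n) \<zeta>)"
    using assms by (intro continuous_intros) auto
  have "2 * T (pCons 0 (\<phi> n)) z
      = wmean w (\<lambda>\<zeta>. (\<zeta> + z) / (\<zeta> - z) * poly (\<phi> n) \<zeta> + poly (\<phi> n) \<zeta> * poly 1 (1 / \<zeta>))"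
    unfolding cauchy_transform_def wmean_cmult [symmetric]
  proof (rule wmean_cong)
    fix \<zeta> :: complex assume "\<zeta> \<in> unit_circle"
    then have "\<zeta> - z \<noteq> 0"
      using assms by auto
    then show "2 * (poly (pCons 0 (\<phi> n)) \<zeta> / (\<zeta> - z))
        = (\<zeta> + z) / (\<zeta> - z) * poly (\<phi> n) \<zeta> + poly (\<phi> n) \<zeta> * poly 1 (1 / \<zeta>)"
      by (simp add: divide_simps) (simp add: algebra_simps)
  qed
  also have "\<dots> = wmean w (\<lambda>\<zeta>. (\<zeta> + z) / (\<zeta> - z) * poly (\<phi> n) \<zeta>) + B (\<phi> n) 1"
    using wmean_add [OF w * continuous_on_pairing_kernel [of "\<phi> n" 1]] by (simp only: pairing_def)
  finally have 1: "2 * T (pCons 0 (\<phi> n)) z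
      = wmean w (\<lambda>\<zeta>. (\<zeta> + z) / (\<zeta> - z) * poly (\<phi> n) \<zeta>) + B (\<phi> n) 1" .
  show ?thesis
  proof (cases "n = 0")
    case True
    obtain c where c: "\<phi> 0 = [:c:]"
      using degree_phi [of 0] by (metis degree_eq_zeroE)
    have "xi w \<phi> 0 z = c * (wmean w (\<lambda>\<zeta>. 1) + wmean w (\<lambda>\<zeta>. (\<zeta> + z) / (\<zeta> - z)))"
      by (simp add: xi_def \<kappa>_def c moment_def wmean_def mult.commute)
    also have "\<dots> = wmean w (\<lambda>\<zeta>. c * ((\<zeta> + z) / (\<zeta> - z))) + wmean w (\<lambda>\<zeta>. c * 1)"
      by (simp only: wmean_cmult distrib_left add.commute)
    finally show ?thesis
      using 1 by (simp add: True c pairing_def mult.commute)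
  next
    case False
    then have "B (\<phi> n) 1 = 0"
      by (intro pairing_phi_eq_0) simp
    with 1 False show ?thesis
      by (simp add: xi_def wmean_def mult_ac)
  qed
qed

text \<open>The definition has z^n where \<phi>*_n has \<zeta>^n. Exchanging them alters the kernel
  by a polynomial in \<zeta> of degree below n, to which \<open>\<phi>b n\<close> is
  orthogonal.\<close>

lemma xi_star_eq:
  assumes "z \<notin> unit_circle"
  shows "xi_star w \<phi>b n z = - 2 * z * T (\<phi>s n) z"
proof (cases "n = 0")
  case True
  obtain c where c: "\<phi>b 0 = [:c:]"
    using degree_phib [of 0] by (metis degree_eq_zeroE)
  have *: "continuous_on unit_circle (\<lambda>\<zeta>. (\<zeta> + z) / (\<zeta> - z))"
    using assms by (intro continuous_intros) auto
  have "- 2 * z * T (\<phi>s 0) z = wmean w (\<lambda>\<zeta>. c * (1 - (\<zeta> + z) / (\<zeta> - z)))"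
    unfolding cauchy_transform_def wmean_cmult [symmetric]
  proof (rule wmean_cong)
    fix \<zeta> :: complex assume "\<zeta> \<in> unit_circle"
    then have "\<zeta> - z \<noteq> 0"
      using assms by auto
    then show "- 2 * z * (poly (\<phi>s 0) \<zeta> / (\<zeta> - z)) = c * (1 - (\<zeta> + z) / (\<zeta> - z))"
      by (simp add: c divide_simps)
  qed
  also have "\<dots> = c * (wmean w (\<lambda>\<zeta>. 1) - wmean w (\<lambda>\<zeta>. (\<zeta> + z) / (\<zeta> - z)))"
    by (simp add: wmean_cmult wmean_diff [OF w _ *])
  finally show ?thesis
    by (simp add: True xi_star_def \<kappa>_def c moment_def wmean_def mult.commute)
next
  case False
  \<comment> \<open>\<open>G(\<zeta>) = (z\<^sup>n (\<zeta> + z) - 2 z \<zeta>\<^sup>n) / (\<zeta> - z)\<close> has degree less than \<open>n\<close>\<close>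
  define G where "G = [:z ^ n:] - smult (2 * z) (\<Sum>i<n. monom (z ^ (n - Suc i)) i)"
  have "degree (\<Sum>i<n. monom (z ^ (n - Suc i)) i) < n"
    using False by (intro degree_sum_less) (auto intro: le_less_trans [OF degree_monom_le])
  then have "degree G < n"
    unfolding G_def using False by (intro degree_diff_less) auto
  then have BG: "B G (\<phi>b n) = 0"
    by (rule pairing_phib_eq_0)
  have *: "continuous_on unit_circle (\<lambda>\<zeta>. - 2 * z * (poly (\<phi>s n) \<zeta> / (\<zeta> - z)))"
    using assms by (intro continuous_intros) auto
  have "wmean w (\<lambda>\<zeta>. - (z ^ n) * ((\<zeta> + z) / (\<zeta> - z) * poly (\<phi>b n) (1 / \<zeta>)))
      = wmean w (\<lambda>\<zeta>. - 2 * z * (poly (\<phi>s n) \<zeta> / (\<zeta> - z)) - poly G \<zeta> * poly (\<phi>b n) (1 / \<zeta>))"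
  proof (rule wmean_cong)
    fix \<zeta> :: complex assume \<zeta>: "\<zeta> \<in> unit_circle"
    then have nz: "\<zeta> - z \<noteq> 0"
      using assms by auto
    define S where "S = (\<Sum>i<n. z ^ (n - Suc i) * \<zeta> ^ i)"
    have S: "\<zeta> ^ n - z ^ n = (\<zeta> - z) * S"
      unfolding S_def by (rule power_diff_sumr2)
    have Gv: "poly G \<zeta> = z ^ n - 2 * z * S"
      by (simp add: G_def S_def poly_sum poly_monom)
    have "poly G \<zeta> * (\<zeta> - z) = z ^ n * (\<zeta> - z) - 2 * z * ((\<zeta> - z) * S)"
      unfolding Gv by (simp add: algebra_simps)
    then have "poly G \<zeta> * (\<zeta> - z) = z ^ n * (\<zeta> - z) - 2 * z * (\<zeta> ^ n - z ^ n)"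
      by (simp only: S)
    then have G: "poly G \<zeta> = (z ^ n * (\<zeta> - z) - 2 * z * (\<zeta> ^ n - z ^ n)) / (\<zeta> - z)"
      using nz by (simp add: eq_divide_eq)
    let ?q = "poly (\<phi>b n) (1 / \<zeta>)"
    have P: "poly (\<phi>s n) \<zeta> = \<zeta> ^ n * ?q"
      using circle_nonzero [OF \<zeta>] by (simp add: poly_reflect_poly_nz inverse_eq_divide)
    have "- b * ((\<zeta> + z) * q) = - 2 * z * (a * q) - (b * (\<zeta> - z) - 2 * z * (a - b)) * q" for a b q
      by algebra
    from arg_cong [OF this [of "z ^ n" ?q "\<zeta> ^ n"], of "\<lambda>t. t / (\<zeta> - z)"]
    show "- (z ^ n) * ((\<zeta> + z) / (\<zeta> - z) * ?q) = - 2 * z * (poly (\<phi>s n) \<zeta> / (\<zeta> - z)) - poly G \<zeta> * ?q"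
      unfolding G P
      by (simp only: diff_divide_distrib [of "- 2 * z * (\<zeta> ^ n * ?q)"] times_divide_eq_left times_divide_eq_right)
  qed
  also have "\<dots> = - 2 * z * T (\<phi>s n) z - B G (\<phi>b n)"
    unfolding pairing_def cauchy_transform_def wmean_cmult [symmetric]
    by (rule wmean_diff [OF w * continuous_on_pairing_kernel])
  finally have "- (z ^ n) * wmean w (\<lambda>\<zeta>. (\<zeta> + z) / (\<zeta> - z) * poly (\<phi>b n) (1 / \<zeta>))
      = - 2 * z * T (\<phi>s n) z - B G (\<phi>b n)"
    by (simp only: wmean_cmult)
  then show ?thesis
    using False BG by (simp add: xi_star_def wmean_def mult_ac)
qed

text \<open>The Szego recurrence paired with 1, to which \<phi>_{n+1} is orthogonal. This relation
  is what cancels the boundary moments.\<close>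

lemma szego_residue: "k (Suc n) * B (pCons 0 (\<phi> n)) 1 + coeff (\<phi> (Suc n)) 0 * B (\<phi>s n) 1 = 0"
proof -
  have "B (smult (k n) (\<phi> (Suc n))) 1 = 0"
    by (simp add: pairing_smult_left pairing_phi_eq_0)
  then show ?thesis
    unfolding szego_recurrence by (simp only: pairing_add_left [OF w] pairing_smult_left)
qed

lemma \<kappa>_phib: "\<kappa> \<phi>b n = k n"
  using lead_coeff_phib by (simp add: \<kappa>_def)

text \<open>
  \<open>D n\<close> below satisfies \<open>\<kappa>\<^sub>n\<^sup>2 D (n + 1) = z (\<kappa>\<^sub>n\<^sub>+\<^sub>1\<^sup>2 - \<phi>\<^sub>n\<^sub>+\<^sub>1(0) \<phi>b\<^sub>n\<^sub>+\<^sub>1(0)) D n\<close>, and the factor is nonzero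
  because \<open>r\<^sub>n\<^sub>+\<^sub>1 rb\<^sub>n\<^sub>+\<^sub>1 \<noteq> 1\<close>.
\<close>

lemma casoratian_nonzero:
  assumes z: "z \<notin> unit_circle" "z \<noteq> 0"
  shows "poly (\<phi> n) z * xi_star w \<phi>b n z + xi w \<phi> n z * poly (\<phi>s n) z \<noteq> 0"
proof -
  note T_simps = cauchy_transform_add [OF w z(1)] cauchy_transform_smult cauchy_transform_pCons [OF w z(1)]
  \<comment> \<open>The expression in the claim is -2 times \<open>D n\<close>. The start value
    \<open>D 0 = - 1\<close> comes from the boundary moment 1 / \<kappa>_0 of \<phi>*_0.\<close>
  define D where "D n = poly (\<phi> n) z * (z * T (\<phi>s n) z) - T (pCons 0 (\<phi> n)) z * poly (\<phi>s n) z" for n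
  have "D n \<noteq> 0"
  proof (induction n)
    case 0
    have "\<phi> 0 = [:k 0:]" "\<phi>b 0 = [:k 0:]"
      using degree_phi [of 0] degree_phib [of 0] lead_coeff_phi [of 0] lead_coeff_phib [of 0]
      by (metis coeff_pCons_0 degree_eq_zeroE)+
    moreover have "B (\<phi>s 0) 1 = 1 / k 0"
      by (rule pairing_phis_1)
    ultimately have "D 0 = - 1"
      by (simp add: D_def cauchy_transform_pCons [OF w z(1)] algebra_simps)
    then show ?case
      by simp
  next
    case (Suc n)
    define k' f g where "k' = k (Suc n)" and "f = coeff (\<phi> (Suc n)) 0" and "g = coeff (\<phi>b (Suc n)) 0"
    define a b p q where "a = T (pCons 0 (\<phi> n)) z" and "b = T (\<phi>s n) z"
      and "p = poly (\<phi> n) z" and "q = poly (\<phi>s n) z"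
    have "k n * poly (\<phi> (Suc n)) z = k' * (z * p) + f * q"
      using arg_cong [OF szego_recurrence [of n], of "\<lambda>p. poly p z"] by (simp add: k'_def f_def p_def q_def)
    moreover have "k n * poly (\<phi>s (Suc n)) z = g * (z * p) + k' * q"
      using arg_cong [OF szego_recurrence_star [of n], of "\<lambda>p. poly p z"] by (simp add: k'_def g_def p_def q_def)
    moreover have "k n * T (\<phi>s (Suc n)) z = g * a + k' * b"
      using arg_cong [OF szego_recurrence_star [of n], of "\<lambda>p. T p z"]
      by (simp only: T_simps(1,2) k'_def g_def a_def b_def)
    \<comment> \<open>The boundary moments cancel by \<open>szego_residue\<close>; the transforms
      thus obey the same homogeneous recurrence as the polynomials, up to a factor z.\<close>
    moreover have "k n * T (pCons 0 (\<phi> (Suc n))) z = z * (k' * a + f * b)"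
    proof -
      have "k n * T (pCons 0 (\<phi> (Suc n))) z = T (pCons 0 (smult (k n) (\<phi> (Suc n)))) z"
        by (simp flip: cauchy_transform_smult)
      also have "\<dots> = k' * B (pCons 0 (\<phi> n)) 1 + f * B (\<phi>s n) 1 + z * (k' * a + f * b)"
        unfolding T_simps(3) szego_recurrence
        by (simp only: pairing_add_left [OF w] pairing_smult_left T_simps(1,2) k'_def f_def a_def b_def)
      finally show ?thesis
        using szego_residue [of n] by (simp add: k'_def f_def)
    qed
    ultimately have "(k n * poly (\<phi> (Suc n)) z) * (z * (k n * T (\<phi>s (Suc n)) z))
        - (k n * T (pCons 0 (\<phi> (Suc n))) z) * (k n * poly (\<phi>s (Suc n)) z)
        = (k' * (z * p) + f * q) * (z * (g * a + k' * b)) - (z * (k' * a + f * b)) * (g * (z * p) + k' * q)"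
      by (simp only:)
    also have "\<dots> = z * (k' * k' - f * g) * D n"
      unfolding D_def a_def [symmetric] b_def [symmetric] p_def [symmetric] q_def [symmetric] by algebra
    finally have "k n * k n * D (Suc n) = z * (k' * k' - f * g) * D n"
      by (simp add: D_def algebra_simps)
    moreover have "k' * k' - f * g \<noteq> 0"
    proof -
      have "verblunsky \<phi> (Suc n) * verblunsky \<phi>b (Suc n) \<noteq> 1"
        using admissible by (simp add: admissible_def)
      then show ?thesis
        using \<kappa>_nonzero [of "Suc n"]
        by (simp add: verblunsky_def \<kappa>_phib k'_def f_def g_def poly_0_coeff_0)
    qed
    ultimately show ?case
      using z Suc by auto
  qed
  then show ?thesis
    by (simp add: D_def xi_eq [OF z(1)] xi_star_eq [OF z(1)] algebra_simps)
qed

end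

section \<open>Multiplying and dividing the weight by \<zeta> - s\<close>

lemma pairing_shift: "pairing (\<lambda>\<zeta>. (\<zeta> - s) * w \<zeta>) p q = pairing w ([:- s, 1:] * p) q"
  unfolding pairing_def wmean_def by (rule circ_mean_cong) (simp add: algebra_simps)

lemma cauchy_transform_shift:
  "cauchy_transform (\<lambda>\<zeta>. (\<zeta> - s) * w \<zeta>) p z = cauchy_transform w ([:- s, 1:] * p) z"
proof -
  have "poly ([:- s, 1:] * p) \<zeta> = (\<zeta> - s) * poly p \<zeta>" for \<zeta>
    by (simp add: algebra_simps)
  then show ?thesis
    by (simp add: cauchy_transform_def wmean_def mult_ac)
qed

lemma pairing_unshift:
  assumes "moments_exist (\<lambda>\<zeta>. w \<zeta> / (\<zeta> - s))"
  shows "pairing w p q = pairing (\<lambda>\<zeta>. w \<zeta> / (\<zeta> - s)) (pCons 0 p) q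
           - s * pairing (\<lambda>\<zeta>. w \<zeta> / (\<zeta> - s)) p q"
proof -
  have "pairing w p q = pairing (\<lambda>\<zeta>. w \<zeta> / (\<zeta> - s)) (pCons 0 p - smult s p) q"
    unfolding pairing_def wmean_def
    by (rule circ_mean_cong_except [of s]) (simp add: field_simps)
  then show ?thesis
    by (simp add: pairing_diff_left [OF assms] pairing_smult_left)
qed

text \<open>Partial fractions: (z - s) / ((\<zeta> - s)(\<zeta> - z)) = 1 / (\<zeta> - z) - 1 /
  (\<zeta> - s).\<close>

lemma cauchy_transform_unshift:
  assumes "moments_exist (\<lambda>\<zeta>. w \<zeta> / (\<zeta> - s))" "z \<notin> unit_circle"
  shows "(z - s) * cauchy_transform (\<lambda>\<zeta>. w \<zeta> / (\<zeta> - s)) p z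
           = cauchy_transform w p z - pairing (\<lambda>\<zeta>. w \<zeta> / (\<zeta> - s)) p 1"
proof -
  have "cauchy_transform w p z = cauchy_transform (\<lambda>\<zeta>. w \<zeta> / (\<zeta> - s)) (pCons 0 p - smult s p) z"
    unfolding cauchy_transform_def wmean_def
  proof (rule circ_mean_cong_except [of s])
    fix \<zeta> :: complex assume "\<zeta> \<in> unit_circle" "\<zeta> \<noteq> s"
    then have "\<zeta> - s \<noteq> 0"
      by simp
    moreover have "poly (pCons 0 p - smult s p) \<zeta> = (\<zeta> - s) * poly p \<zeta>"
      by (simp add: algebra_simps)
    ultimately show "w \<zeta> * (poly p \<zeta> / (\<zeta> - z))
        = w \<zeta> / (\<zeta> - s) * (poly (pCons 0 p - smult s p) \<zeta> / (\<zeta> - z))"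
      by simp
  qed
  then show ?thesis
    by (simp add: cauchy_transform_diff [OF assms] cauchy_transform_smult cauchy_transform_pCons [OF assms]
          algebra_simps)
qed

text \<open>Write w(\<zeta>) / (\<zeta> - r s) as the lowered weight times (\<zeta> - s) / (\<zeta>
  - r s). This factor is at most 2 in modulus, because |r s - s| = |r - 1| is the distance of r s
  from the circle and hence at most |\<zeta> - r s|.\<close>

lemma cauchy_transform_radial_limit:
  assumes v: "moments_exist (\<lambda>\<zeta>. w \<zeta> / (\<zeta> - s))" and s: "s \<in> unit_circle"
  shows "((\<lambda>r::real. cauchy_transform w p (of_real r * s)) \<longlongrightarrow> pairing (\<lambda>\<zeta>. w \<zeta> / (\<zeta> - s)) p 1) (at 1)"
proof -
  let ?S = "{0<..} - {1::real}"
  let ?v = "\<lambda>\<zeta>. w \<zeta> / (\<zeta> - s)"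
  have at: "at 1 within ?S = at (1::real)"
    by (rule at_within_nhd [of _ "{0<..}"]) auto
  obtain C where C: "\<And>\<zeta>. \<zeta> \<in> unit_circle \<Longrightarrow> norm (poly p \<zeta>) \<le> C"
    using compact_imp_bounded [OF compact_continuous_image [of unit_circle "poly p"]]
    by (force simp: bounded_iff intro: continuous_intros)
  have off: "of_real r * s \<notin> unit_circle" if "r \<in> ?S" for r
    using that s by (simp add: norm_mult)
  have "((\<lambda>r. wmean ?v (\<lambda>\<zeta>. poly p \<zeta> * ((\<zeta> - s) / (\<zeta> - of_real r * s))))
      \<longlongrightarrow> wmean ?v (\<lambda>\<zeta>. poly p \<zeta> * poly 1 (1 / \<zeta>))) (at 1 within ?S)"
  proof (rule tendsto_wmean [OF v, where C = "C * 2" and s = s])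
    fix r assume r: "r \<in> ?S"
    show "continuous_on unit_circle (\<lambda>\<zeta>. poly p \<zeta> * ((\<zeta> - s) / (\<zeta> - of_real r * s)))"
      using off [OF r] by (intro continuous_intros) auto
    fix \<zeta> :: complex assume \<zeta>: "\<zeta> \<in> unit_circle"
    have "norm (\<zeta> - s) \<le> norm (\<zeta> - of_real r * s) + norm (of_real r * s - s)"
      using norm_triangle_ineq [of "\<zeta> - of_real r * s" "of_real r * s - s"] by simp
    also have "of_real r * s - s = of_real (r - 1) * s"
      by (simp add: algebra_simps)
    also have "norm (of_real (r - 1) * s) = \<bar>norm \<zeta> - norm (of_real r * s)\<bar>"
      using \<zeta> s r by (simp add: norm_mult del: of_real_diff)
    also have "\<dots> \<le> norm (\<zeta> - of_real r * s)"
      by (rule norm_triangle_ineq3)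
    finally have "norm (\<zeta> - s) \<le> 2 * norm (\<zeta> - of_real r * s)"
      by simp
    moreover have "\<zeta> \<noteq> of_real r * s"
      using off [OF r] \<zeta> by blast
    ultimately have "norm ((\<zeta> - s) / (\<zeta> - of_real r * s)) \<le> 2"
      by (simp add: norm_divide divide_simps)
    then show "norm (poly p \<zeta> * ((\<zeta> - s) / (\<zeta> - of_real r * s))) \<le> C * 2"
      unfolding norm_mult
      by (intro mult_mono C \<zeta> order_trans [OF norm_ge_zero C [OF \<zeta>]]) simp_all
  next
    fix \<zeta> :: complex assume "\<zeta> \<in> unit_circle" "\<zeta> \<noteq> s"
    then have "((\<lambda>r. poly p \<zeta> * ((\<zeta> - s) / (\<zeta> - of_real r * s))) \<longlongrightarrow>
        poly p \<zeta> * ((\<zeta> - s) / (\<zeta> - of_real 1 * s))) (at 1 within ?S)"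
      by (intro tendsto_intros) auto
    then show "((\<lambda>r. poly p \<zeta> * ((\<zeta> - s) / (\<zeta> - of_real r * s))) \<longlongrightarrow>
        poly p \<zeta> * poly 1 (1 / \<zeta>)) (at 1 within ?S)"
      using \<open>\<zeta> \<noteq> s\<close> by simp
  qed
  moreover have "wmean ?v (\<lambda>\<zeta>. poly p \<zeta> * ((\<zeta> - s) / (\<zeta> - of_real r * s)))
      = cauchy_transform w p (of_real r * s)" for r
    unfolding cauchy_transform_def wmean_def
    by (rule circ_mean_cong_except [of s]) simp
  ultimately show ?thesis
    by (simp only: at pairing_def)
qed

text \<open>Off the circle the kernel 1 / (\<zeta> - s) of \<open>T\<close> at s is itself the
  factor of the lowered weight; on the circle the radial limit gives the same moment. The function
  \<open>g\<close> carries the factors 2 and -2 z of \<xi> and \<xi>*.\<close>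

lemma value_at_cauchy_transform:
  assumes v: "moments_exist (\<lambda>\<zeta>. w \<zeta> / (\<zeta> - s))" and s: "s \<noteq> 0"
    and f: "\<And>z. z \<notin> unit_circle \<Longrightarrow> f z = g z * cauchy_transform w p z" and g: "isCont g s"
  shows "value_at f s = g s * pairing (\<lambda>\<zeta>. w \<zeta> / (\<zeta> - s)) p 1"
proof (cases "s \<in> unit_circle")
  case True
  have "((\<lambda>r::real. g (of_real r * s)) \<longlongrightarrow> g s) (at 1)"
    by (rule isCont_tendsto_compose [OF g]) (auto intro!: tendsto_eq_intros)
  from tendsto_mult [OF this cauchy_transform_radial_limit [OF v True, of p]]
  have lim: "((\<lambda>r::real. g (of_real r * s) * cauchy_transform w p (of_real r * s))
      \<longlongrightarrow> g s * pairing (\<lambda>\<zeta>. w \<zeta> / (\<zeta> - s)) p 1) (at 1)" .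
  have "eventually (\<lambda>r::real. r \<in> {0<..}) (at 1)"
    by (intro eventually_at_in_open') auto
  then have "eventually (\<lambda>r::real. g (of_real r * s) * cauchy_transform w p (of_real r * s) = f (of_real r * s)) (at 1)"
    using eventually_neq_at_within [of 1 1 UNIV]
  proof eventually_elim
    case (elim r)
    then have "of_real r * s \<notin> unit_circle"
      using True by (simp add: norm_mult)
    then show ?case
      by (simp add: f)
  qed
  with lim have "((\<lambda>r::real. f (of_real r * s)) \<longlongrightarrow> g s * pairing (\<lambda>\<zeta>. w \<zeta> / (\<zeta> - s)) p 1) (at 1)"
    by (rule Lim_transform_eventually)
  then show ?thesis
    using True by (simp add: value_at_def tendsto_Lim)
next
  case False
  have "cauchy_transform w p s = pairing (\<lambda>\<zeta>. w \<zeta> / (\<zeta> - s)) p 1"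
    unfolding cauchy_transform_def pairing_def wmean_def by (rule circ_mean_cong) simp
  then show ?thesis
    using False by (simp add: value_at_def f)
qed

section \<open>Raising an exponent\<close>

lemma mat2_mult: "mat2 a b c d ** mat2 e f g h = mat2 (a*e + b*g) (a*f + b*h) (c*e + d*g) (c*f + d*h)"
  by (simp add: vec_eq_iff matrix_matrix_mult_def mat2_def sum_2 forall_2)

lemma mat2_eq_iff: "mat2 a b c d = mat2 e f g h \<longleftrightarrow> a = e \<and> b = f \<and> c = g \<and> d = h"
  by (auto simp: vec_eq_iff mat2_def forall_2)

locale schlesinger_plus = biorth w \<phi> \<phi>b + plus: biorth "\<lambda>\<zeta>. (\<zeta> - s) * w \<zeta>" \<phi>p \<phi>bp
  for w \<phi> \<phi>b s \<phi>p \<phi>bp +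
  assumes s: "s \<noteq> 0" and phi_s: "\<And>n. poly (\<phi> n) s \<noteq> 0"
begin

text \<open>The two coefficient relations transport the normalisations asked for by
  \<open>unique_phi\<close> and \<open>unique_phi_star\<close> through the division.\<close>

lemma divides:
  assumes "poly F s = 0" "degree F \<le> Suc n"
  obtains G where "F = [:- s, 1:] * G" "degree G \<le> n" "coeff G n = coeff F (Suc n)" "- s * coeff G 0 = coeff F 0"
proof -
  obtain G where G: "F = [:- s, 1:] * G"
    using assms(1) by (auto simp: poly_eq_0_iff_dvd)
  have deg: "degree G \<le> n"
  proof (cases "G = 0")
    case False
    then have "degree F = 1 + degree G"
      unfolding G by (subst degree_mult_eq) auto
    then show ?thesis
      using assms(2) by simp
  qed simp
  show ?thesis
    by (rule that [OF G deg]) (use deg in \<open>simp_all add: G coeff_eq_0\<close>)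
qed

text \<open>\<open>a n\<close> makes (\<kappa>_n / \<kappa>_{n+1}) \<phi>_{n+1} - a_n \<phi>_n
  vanish at s, \<open>t n\<close> does the same for t_n \<zeta> \<phi>_n - s \<phi>*_n, and
  \<open>b n\<close> arises when \<phi>_{n+1} is eliminated by the Szego recurrence.\<close>

abbreviation ratio where "ratio n \<equiv> \<kappa> \<phi>p n / k n"
abbreviation a where "a n \<equiv> k n * poly (\<phi> (Suc n)) s / (k (Suc n) * poly (\<phi> n) s)"
abbreviation b where "b n \<equiv> coeff (\<phi> (Suc n)) 0 / k (Suc n)"
abbreviation t where "t n \<equiv> poly (\<phi>s n) s / poly (\<phi> n) s"

text \<open>Christoffel's construction: a combination of \<phi>_{n+1} and \<phi>_n with a zero at s,
  divided by \<zeta> - s, is orthogonal to 1, ..., \<zeta>^(n-1) for the raised weight;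
  \<open>ratio n\<close> fixes its leading coefficient.\<close>

lemma phi_plus:
  "[:- s, 1:] * \<phi>p n = smult (ratio n) (pCons 0 (\<phi> n) - smult (a n) (\<phi> n) + smult (b n) (\<phi>s n))"
proof -
  define F where "F = smult (ratio n) (smult (k n / k (Suc n)) (\<phi> (Suc n)) - smult (a n) (\<phi> n))"
  have "smult (1 / k (Suc n)) (smult (k n) (\<phi> (Suc n)))
      = smult (1 / k (Suc n)) (smult (k (Suc n)) (pCons 0 (\<phi> n)) + smult (coeff (\<phi> (Suc n)) 0) (\<phi>s n))"
    by (simp only: szego_recurrence)
  then have "smult (k n / k (Suc n)) (\<phi> (Suc n)) = pCons 0 (\<phi> n) + smult (b n) (\<phi>s n)"
    by (simp add: smult_add_right)
  then have F: "F = smult (ratio n) (pCons 0 (\<phi> n) - smult (a n) (\<phi> n) + smult (b n) (\<phi>s n))"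
    unfolding F_def by (simp add: algebra_simps)
  have "poly F s = 0"
    using phi_s [of n] by (simp add: F_def)
  moreover have "degree F \<le> Suc n"
    unfolding F_def by (intro degree_diff_le order_trans [OF degree_smult_le]) auto
  ultimately obtain G where G: "F = [:- s, 1:] * G" "degree G \<le> n" "coeff G n = coeff F (Suc n)"
    using divides by blast
  have "G - \<phi>p n = 0"
  proof (rule plus.unique_phi)
    show "degree (G - \<phi>p n) \<le> n"
      using G(2) by (intro degree_diff_le) auto
    show "coeff (G - \<phi>p n) n = 0"
      by (simp add: G(3) plus.lead_coeff_phi) (simp add: F_def lead_coeff_phi coeff_eq_0)
    show "pairing (\<lambda>\<zeta>. (\<zeta> - s) * w \<zeta>) (G - \<phi>p n) (monom 1 j) = 0" if "j < n" for j
    proof -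
      have "pairing w F (monom 1 j) = 0"
        using that by (simp add: F_def pairing_simps)
      then have "pairing (\<lambda>\<zeta>. (\<zeta> - s) * w \<zeta>) G (monom 1 j) = 0"
        unfolding pairing_shift G(1) .
      then show ?thesis
        using that by (simp only: pairing_diff_left [OF plus.w] plus.pairing_phi diff_self)
    qed
  qed
  then show ?thesis
    using G(1) by (simp add: F)
qed

text \<open>Both \<zeta> \<phi>_n and \<phi>*_n are orthogonal to \<zeta>, ..., \<zeta>^n, and this
  survives the division. The coefficient -s of \<phi>*_n fixes the constant term of the
  quotient.\<close>

lemma phi_star_plus:
  "[:- s, 1:] * plus.\<phi>s n = smult (ratio n) (smult (t n) (pCons 0 (\<phi> n)) - smult s (\<phi>s n))"
proof -
  define F where "F = smult (ratio n) (smult (t n) (pCons 0 (\<phi> n)) - smult s (\<phi>s n))"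
  have "poly F s = 0"
    using phi_s [of n] by (simp add: F_def)
  moreover have "degree F \<le> Suc n"
    unfolding F_def
    by (intro degree_diff_le order_trans [OF degree_smult_le])
       (auto simp: degree_pCons_eq intro: le_SucI [OF degree_phis])
  ultimately obtain G where G: "F = [:- s, 1:] * G" "degree G \<le> n" "- s * coeff G 0 = coeff F 0"
    using divides by blast
  have "G - plus.\<phi>s n = 0"
  proof (rule plus.unique_phi_star)
    show "degree (G - plus.\<phi>s n) \<le> n"
      using G(2) plus.degree_phis by (intro degree_diff_le) auto
    have "- s * coeff G 0 = - s * \<kappa> \<phi>p n"
      unfolding G(3) by (simp add: F_def lead_coeff_phib)
    then show "coeff (G - plus.\<phi>s n) 0 = 0"
      using s by (simp add: plus.lead_coeff_phib)
    show "pairing (\<lambda>\<zeta>. (\<zeta> - s) * w \<zeta>) (G - plus.\<phi>s n) (monom 1 j) = 0" if "1 \<le> j" "j \<le> n" for j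
    proof -
      have "pairing w F (monom 1 j) = 0"
        using that by (simp add: F_def pairing_simps del: smult_pCons)
      then have "pairing (\<lambda>\<zeta>. (\<zeta> - s) * w \<zeta>) G (monom 1 j) = 0"
        unfolding pairing_shift G(1) .
      then show ?thesis
        using that by (simp add: pairing_diff_left [OF plus.w] plus.pairing_phis)
    qed
  qed
  then show ?thesis
    using G(1) by (simp add: F_def)
qed

lemma Y_plus:
  assumes z: "z \<notin> unit_circle" "z \<noteq> s" and \<omega>: "\<omega> z \<noteq> 0"
  shows "Y_mat (\<lambda>\<zeta>. (\<zeta> - s) * w \<zeta>) (\<lambda>u. (u - s) * \<omega> u) \<phi>p \<phi>bp n z
           = R_plus \<phi> \<phi>b \<phi>p s n z ** Y_mat w \<omega> \<phi> \<phi>b n z"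
proof -
  note T_simps = cauchy_transform_add [OF w z(1)] cauchy_transform_diff [OF w z(1)] cauchy_transform_smult
  note T_pCons = cauchy_transform_pCons [OF w z(1)]
  define x xs where "x = xi w \<phi> n z" and "xs = xi_star w \<phi>b n z"
  define r where "r = ratio n"
  have x: "x = 2 * T (pCons 0 (\<phi> n)) z" and xs: "xs = - 2 * z * T (\<phi>s n) z"
    by (simp_all only: x_def xs_def xi_eq [OF z(1)] xi_star_eq [OF z(1)])
  have zs: "z - s \<noteq> 0"
    using z(2) by simp
  define A b' t' where "A = a n" and "b' = b n" and "t' = t n"
  define p q where "p = poly (\<phi> n) z" and "q = poly (\<phi>s n) z"
  have "(z - s) * poly (\<phi>p n) z = r * ((z - A) * p + b' * q)"
    using arg_cong [OF phi_plus [of n], of "\<lambda>p. poly p z"]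
    by (simp add: r_def A_def b'_def p_def q_def algebra_simps)
  then have 11: "poly (\<phi>p n) z = r * ((z - A) * p + b' * q) / (z - s)"
    using zs by (simp add: eq_divide_eq mult.commute)
  have "(z - s) * poly (plus.\<phi>s n) z = r * (t' * z * p - s * q)"
    using arg_cong [OF phi_star_plus [of n], of "\<lambda>p. poly p z"]
    by (simp add: r_def t'_def p_def q_def algebra_simps)
  then have 21: "poly (plus.\<phi>s n) z = r * (t' * z * p - s * q) / (z - s)"
    using zs by (simp add: eq_divide_eq mult.commute)
  \<comment> \<open>No denominator z - s appears in the second column, as \<zeta> - s is absorbed by
    the raised weight; it returns on division by the branch (z - s) \<omega>(z).\<close>
  have 12: "xi (\<lambda>\<zeta>. (\<zeta> - s) * w \<zeta>) \<phi>p n z = r * ((z - A) * x - b' * xs)"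
  proof -
    have "[:- s, 1:] * pCons 0 (\<phi>p n) = pCons 0 ([:- s, 1:] * \<phi>p n)"
      by (simp add: mult_pCons_right)
    then have "xi (\<lambda>\<zeta>. (\<zeta> - s) * w \<zeta>) \<phi>p n z = 2 * T (pCons 0 ([:- s, 1:] * \<phi>p n)) z"
      unfolding plus.xi_eq [OF z(1)] cauchy_transform_shift by simp
    also have "pCons 0 ([:- s, 1:] * \<phi>p n) = smult r
        (pCons 0 (pCons 0 (\<phi> n)) - smult A (pCons 0 (\<phi> n)) + smult b' (pCons 0 (\<phi>s n)))"
      unfolding phi_plus r_def A_def b'_def by simp
    also have "2 * T \<dots> z = r * ((z - A) * x - b' * xs) + 2 * r * (B (pCons 0 (\<phi> n)) 1 + b' * B (\<phi>s n) 1)"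
      unfolding T_simps T_pCons [of "pCons 0 (\<phi> n)"] T_pCons [of "\<phi>s n"] x xs
      by (simp add: algebra_simps)
    also have "B (pCons 0 (\<phi> n)) 1 + b' * B (\<phi>s n) 1 = 0"
      using szego_residue [of n] by (simp add: b'_def field_simps)
    finally show ?thesis
      by simp
  qed
  have 22: "- xi_star (\<lambda>\<zeta>. (\<zeta> - s) * w \<zeta>) \<phi>bp n z = r * (t' * z * x + s * xs)"
    unfolding plus.xi_star_eq [OF z(1)] cauchy_transform_shift phi_star_plus T_simps x xs r_def t'_def
    by (simp add: algebra_simps)
  have R: "R_plus \<phi> \<phi>b \<phi>p s n z
      = mat2 (r * (z - A) / (z - s)) (r * b' / (z - s)) (r * (t' * z) / (z - s)) (r * (- s) / (z - s))"
    by (simp add: R_plus_def mat2_eq_iff r_def A_def b'_def t'_def phi_star_def poly_0_coeff_0)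
  show ?thesis
    unfolding Y_mat_def R mat2_mult mat2_eq_iff 11 12 21 22
      x_def [symmetric] xs_def [symmetric] p_def [symmetric] phi_star_def q_def [symmetric]
    using zs \<omega> by (intro conjI; simp add: divide_simps; simp add: algebra_simps)
qed

end

section \<open>Lowering an exponent\<close>

locale schlesinger_minus = biorth w \<phi> \<phi>b + minus: biorth "\<lambda>\<zeta>. w \<zeta> / (\<zeta> - s)" \<phi>m \<phi>bm
  for w \<phi> \<phi>b s \<phi>m \<phi>bm +
  assumes s: "s \<noteq> 0" and xi_star_s: "\<And>n. value_at (xi_star w \<phi>b n) s \<noteq> 0"
begin

abbreviation P where "P \<equiv> pairing (\<lambda>\<zeta>. w \<zeta> / (\<zeta> - s))"
abbreviation X where "X n \<equiv> value_at (xi w \<phi> n) s"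
abbreviation Xs where "Xs n \<equiv> value_at (xi_star w \<phi>b n) s"

text \<open>From here on the values at s, possibly limits, are ordinary moments of the lowered
  weight.\<close>

lemma X_eq: "X n = 2 * P (pCons 0 (\<phi> n)) 1"
  by (rule value_at_cauchy_transform [OF minus.w s]) (simp_all add: xi_eq)

lemma Xs_eq: "Xs n = - 2 * s * P (\<phi>s n) 1"
  by (rule value_at_cauchy_transform [OF minus.w s, where g = "\<lambda>z. - 2 * z"])
     (auto simp: xi_star_eq intro!: continuous_intros)

lemma P_pCons: "P (pCons 0 p) q = B p q + s * P p q"
  using pairing_unshift [OF minus.w, of p q] by simp

text \<open>
  As \<open>w(\<zeta>) = (\<zeta> - s) w\<^sup>-(\<zeta>)\<close>, vanishing moments against \<open>w\<close> make the moments against \<open>w\<^sup>-\<close> a geometric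
  progression of ratio \<open>1 / s\<close>.
\<close>

lemma P_geometric:
  assumes "\<And>i. 1 \<le> i \<Longrightarrow> i \<le> n \<Longrightarrow> B f (monom 1 i) = 0" "j \<le> n"
  shows "s ^ j * P f (monom 1 j) = P f 1"
  using assms(2)
proof (induction j)
  case (Suc j)
  have "P f (monom 1 j) = P (pCons 0 f) (monom 1 (Suc j))"
    by (simp add: monom_Suc pairing_pCons)
  also have "\<dots> = s * P f (monom 1 (Suc j))"
    using Suc.prems by (simp add: P_pCons assms(1))
  finally show ?case
    using Suc by (simp add: mult_ac)
qed simp

lemma P_phi_1: "P (\<phi> (Suc n)) 1 = X (Suc n) / (2 * s)"
  using P_pCons [of "\<phi> (Suc n)" 1] s by (simp add: X_eq pairing_phi_eq_0)

lemma P_phis_1: "P (\<phi>s n) 1 = - Xs n / (2 * s)"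
  using s by (simp add: Xs_eq)

lemma P_phi: "j \<le> n \<Longrightarrow> P (\<phi> (Suc n)) (monom 1 j) = X (Suc n) / (2 * s * s ^ j)"
  using P_geometric [of n "\<phi> (Suc n)" j] s by (simp add: pairing_phi P_phi_1 divide_simps mult_ac)

lemma P_phis: "j \<le> n \<Longrightarrow> P (\<phi>s n) (monom 1 j) = - Xs n / (2 * s * s ^ j)"
  using P_geometric [of n "\<phi>s n" j] s by (simp add: pairing_phis P_phis_1 divide_simps mult_ac)

text \<open>The inverse recurrence integrated against the lowered weight. It evaluates the leading
  coefficient of the combination in \<open>phi_minus\<close> as \<kappa>_n \<xi>*_n(s), nonzero by
  assumption; hence the lower index in the denominators of R^-.\<close>

lemma xi_s_recurrence:
  "k n * Xs n = k (Suc n) * Xs (Suc n) + coeff (\<phi>b (Suc n)) 0 * X (Suc n)"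
proof -
  have "k n * P (\<phi>s n) 1 = k (Suc n) * P (\<phi>s (Suc n)) 1 - coeff (\<phi>b (Suc n)) 0 * P (\<phi> (Suc n)) 1"
    using arg_cong [OF inverse_szego_recurrence_star [of n], of "\<lambda>p. P p 1"]
    by (simp only: pairing_diff_left [OF minus.w] pairing_smult_left)
  then show ?thesis
    using s by (simp add: P_phi_1 P_phis_1 field_simps)
qed

abbreviation ratio where "ratio n \<equiv> \<kappa> \<phi>m n / k n"

text \<open>The moments of \<phi>_{n+1} and \<phi>*_{n+1} against the lowered weight are
  proportional sequences with initial terms X / (2 s) and -Xs / (2 s), so the cross combination
  annihilates all of them.\<close>

lemma phi_minus:
  "\<phi>m (Suc n) = smult (\<kappa> \<phi>m (Suc n) / (k n * Xs n))
     (smult (Xs (Suc n)) (\<phi> (Suc n)) + smult (X (Suc n)) (\<phi>s (Suc n)))" (is "_ = smult ?e ?f")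
proof -
  have nz: "k n * Xs n \<noteq> 0"
    using xi_star_s by simp
  have "smult ?e ?f - \<phi>m (Suc n) = 0"
  proof (rule minus.unique_phi)
    show "degree (smult ?e ?f - \<phi>m (Suc n)) \<le> Suc n"
      by (intro degree_diff_le degree_add_le order_trans [OF degree_smult_le]) (auto intro: degree_phis)
    have "coeff ?f (Suc n) = k n * Xs n"
      unfolding xi_s_recurrence [of n] by (simp add: lead_coeff_phi coeff_reflect_poly mult.commute)
    then have "coeff (smult ?e ?f) (Suc n) = \<kappa> \<phi>m (Suc n)"
      unfolding coeff_smult using nz by simp
    then show "coeff (smult ?e ?f - \<phi>m (Suc n)) (Suc n) = 0"
      by (simp only: coeff_diff minus.lead_coeff_phi diff_self)
    show "P (smult ?e ?f - \<phi>m (Suc n)) (monom 1 j) = 0" if "j < Suc n" for j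
    proof -
      have "P ?f (monom 1 j) = 0"
        using that by (simp add: pairing_add_left [OF minus.w] pairing_smult_left P_phi P_phis)
      then show ?thesis
        using that by (simp only: pairing_diff_left [OF minus.w] pairing_smult_left minus.pairing_phi) simp
    qed
  qed
  then show ?thesis
    by simp
qed

text \<open>The moments of \<zeta> \<phi>*_n are those of \<phi>*_n moved by one place, again of
  ratio 1 / s, so one multiple cancels those of \<phi>*_{n+1}. Having no constant term, \<zeta>
  \<phi>*_n leaves the normalisation to \<phi>*_{n+1}.\<close>

lemma phi_star_minus:
  "minus.\<phi>s (Suc n) = smult (ratio (Suc n))
     (\<phi>s (Suc n) - smult (Xs (Suc n) / (s * Xs n)) (pCons 0 (\<phi>s n)))" (is "_ = smult ?e ?f")
proof -
  have nz: "Xs n \<noteq> 0"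
    by (rule xi_star_s)
  have "smult ?e ?f - minus.\<phi>s (Suc n) = 0"
  proof (rule minus.unique_phi_star)
    have "degree (pCons 0 (\<phi>s n)) \<le> Suc n"
      using degree_phis [of n] by (simp add: degree_pCons_le)
    then show "degree (smult ?e ?f - minus.\<phi>s (Suc n)) \<le> Suc n"
      by (intro degree_diff_le order_trans [OF degree_smult_le]) (auto intro: degree_phis minus.degree_phis)
    show "coeff (smult ?e ?f - minus.\<phi>s (Suc n)) 0 = 0"
      by (simp add: lead_coeff_phib minus.lead_coeff_phib)
    show "P (smult ?e ?f - minus.\<phi>s (Suc n)) (monom 1 j) = 0" if "1 \<le> j" "j \<le> Suc n" for j
    proof -
      obtain i where i: "j = Suc i"
        using \<open>1 \<le> j\<close> by (cases j) auto
      have "P (pCons 0 (\<phi>s n)) (monom 1 j) = - Xs n / (2 * s * s ^ i)"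
        using that(2) by (simp add: i monom_Suc pairing_pCons P_phis)
      moreover have "P (\<phi>s (Suc n)) (monom 1 j) = - Xs (Suc n) / (2 * s * s ^ j)"
        by (rule P_phis [OF that(2)])
      ultimately have "P ?f (monom 1 j) = 0"
        using s nz by (simp add: pairing_diff_left [OF minus.w] pairing_smult_left i del: smult_pCons)
      then show ?thesis
        using that
        by (simp only: pairing_diff_left [OF minus.w] pairing_smult_left minus.pairing_phis) simp
    qed
  qed
  then show ?thesis
    by simp
qed

lemma Y_minus:
  assumes n: "n \<ge> 1" and z: "z \<notin> unit_circle" "z \<noteq> s" and \<omega>: "\<omega> z \<noteq> 0"
  shows "Y_mat (\<lambda>\<zeta>. w \<zeta> / (\<zeta> - s)) (\<lambda>u. \<omega> u / (u - s)) \<phi>m \<phi>bm n z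
           = R_minus w \<phi> \<phi>b \<phi>m s n z ** Y_mat w \<omega> \<phi> \<phi>b n z"
proof -
  obtain m where m: "n = Suc m"
    using n by (cases n) auto
  note T_simps = cauchy_transform_add [OF w z(1)] cauchy_transform_diff [OF w z(1)] cauchy_transform_smult
  note T_pCons = cauchy_transform_pCons [OF w z(1)]
  note P_simps = pairing_add_left [OF minus.w] pairing_diff_left [OF minus.w] pairing_smult_left
  define x xs where "x = xi w \<phi> n z" and "xs = xi_star w \<phi>b n z"
  define \<kappa>n \<kappa>m \<kappa>' where "\<kappa>n = k n" and "\<kappa>m = k m" and "\<kappa>' = \<kappa> \<phi>m n"
  define u us d g where "u = X n" and "us = Xs n" and "d = Xs m" and "g = coeff (\<phi>b n) 0"
  define p q where "p = poly (\<phi> n) z" and "q = poly (\<phi>s n) z"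
  define v vs where "v = T (\<phi> n) z" and "vs = T (\<phi>s n) z"
  note defs = \<kappa>n_def \<kappa>m_def \<kappa>'_def u_def us_def d_def g_def p_def q_def v_def vs_def
  have nz: "\<kappa>n \<noteq> 0" "\<kappa>m \<noteq> 0" "d \<noteq> 0" "z - s \<noteq> 0"
    using z(2) xi_star_s by (simp_all add: defs)
  have x: "x = 2 * (z * v)" and xs: "xs = - 2 * z * vs"
    by (simp_all add: x_def xs_def xi_eq [OF z(1)] xi_star_eq [OF z(1)] T_pCons defs m pairing_phi_eq_0)
  \<comment> \<open>The entries of R^- become E us, E u, E' c G z and E' (1 - c h z).\<close>
  define E E' c G h where "E = \<kappa>' / (\<kappa>m * d)" and "E' = \<kappa>' / \<kappa>n"
    and "c = us / (s * d)" and "G = g / \<kappa>m" and "h = \<kappa>n / \<kappa>m"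
  have B1: "B (\<phi>s n) 1 = 1 / \<kappa>n" "B (\<phi>s m) 1 = 1 / \<kappa>m" "B (\<phi> n) 1 = 0"
    by (simp_all add: pairing_phis_1 defs m pairing_phi_eq_0)
  have P1: "s * P (\<phi> n) 1 = u / 2" "s * P (\<phi>s n) 1 = - us / 2" "s * P (\<phi>s m) 1 = - d / 2"
    using P_phi_1 [of m] P_phis_1 s by (simp_all add: defs m)
  have P_n: "P (\<phi>s n) 1 = - (c * (d / 2))"
    using P_phis_1 [of n] nz by (simp add: c_def us_def)
  \<comment> \<open>The inverse recurrence returns \<phi>*_{n-1} and its transform to index n, where
    they are combinations of the entries of Y_n.\<close>
  have q_rec: "poly (\<phi>s m) z = h * q - G * p"
    using arg_cong [OF inverse_szego_recurrence_star [of m], of "\<lambda>p. poly p z"] nz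
    by (simp add: h_def G_def defs m field_simps)
  have "\<kappa>m * T (\<phi>s m) z = \<kappa>n * vs - g * v"
    using arg_cong [OF inverse_szego_recurrence_star [of m], of "\<lambda>p. T p z"]
    by (simp only: T_simps defs m)
  then have vs_rec: "T (\<phi>s m) z = h * vs - G * v"
    using nz by (simp add: h_def G_def field_simps)
  have pm: "\<phi>m n = smult E (smult us (\<phi> n) + smult u (\<phi>s n))"
    unfolding m phi_minus by (simp add: E_def defs m)
  have psm: "minus.\<phi>s n = smult E' (\<phi>s n - smult c (pCons 0 (\<phi>s m)))"
    unfolding m phi_star_minus by (simp add: E'_def c_def defs m)
  have 11: "poly (\<phi>m n) z = E * (us * p + u * q)"
    by (simp add: pm p_def q_def)
  have 21: "poly (minus.\<phi>s n) z = E' * (q - c * (z * (h * q - G * p)))"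
    by (simp add: psm q_rec) (simp add: q_def)
  have "(z - s) * xi (\<lambda>\<zeta>. w \<zeta> / (\<zeta> - s)) \<phi>m n z = E * (us * x - u * xs)"
  proof -
    have pm': "pCons 0 (\<phi>m n) = smult E (smult us (pCons 0 (\<phi> n)) + smult u (pCons 0 (\<phi>s n)))"
      by (simp add: pm)
    have "(z - s) * xi (\<lambda>\<zeta>. w \<zeta> / (\<zeta> - s)) \<phi>m n z
        = 2 * (T (pCons 0 (\<phi>m n)) z - P (pCons 0 (\<phi>m n)) 1)"
      unfolding minus.xi_eq [OF z(1)] cauchy_transform_unshift [OF minus.w z(1), symmetric] by simp
    \<comment> \<open>The moments against w cancel between \<open>T\<close> and \<open>P\<close>;
      what remains of \<open>P\<close> is -us u / 2 + u us / 2 = 0.\<close>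
    also have "\<dots> = E * (us * x - u * xs)"
      unfolding pm' T_simps P_simps T_pCons P_pCons B1 P1 v_def [symmetric] vs_def [symmetric] x xs
      by (simp add: algebra_simps)
    finally show ?thesis .
  qed
  then have 12: "xi (\<lambda>\<zeta>. w \<zeta> / (\<zeta> - s)) \<phi>m n z = E * (us * x - u * xs) / (z - s)"
    using nz(4) by (metis nonzero_mult_div_cancel_left)
  have "(z - s) * - xi_star (\<lambda>\<zeta>. w \<zeta> / (\<zeta> - s)) \<phi>bm n z = E' * (- xs + c * (z * (G * x + h * xs)))"
  proof -
    have "(z - s) * - xi_star (\<lambda>\<zeta>. w \<zeta> / (\<zeta> - s)) \<phi>bm n z
        = 2 * z * (T (minus.\<phi>s n) z - P (minus.\<phi>s n) 1)"
      unfolding minus.xi_star_eq [OF z(1)] cauchy_transform_unshift [OF minus.w z(1), symmetric] by simp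
    also have "\<dots> = E' * (- xs + c * (z * (G * x + h * xs)))"
      unfolding psm T_simps P_simps T_pCons P_pCons B1 P1 P_n vs_rec vs_def [symmetric] x xs
      by (simp add: algebra_simps)
    finally show ?thesis .
  qed
  then have 22: "- xi_star (\<lambda>\<zeta>. w \<zeta> / (\<zeta> - s)) \<phi>bm n z
      = E' * (- xs + c * (z * (G * x + h * xs))) / (z - s)"
    using nz(4) by (metis nonzero_mult_div_cancel_left)
  have R: "R_minus w \<phi> \<phi>b \<phi>m s n z = mat2 (E * us) (E * u) (E' * (c * G * z)) (E' * (1 - c * h * z))"
    using nz by (simp add: R_minus_def Let_def mat2_eq_iff E_def E'_def c_def G_def h_def defs m
        poly_0_coeff_0 mult_ac)
  show ?thesis
    unfolding Y_mat_def R mat2_mult mat2_eq_iff 11 12 21 22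
      x_def [symmetric] xs_def [symmetric] p_def [symmetric] phi_star_def q_def [symmetric]
    using nz(4) \<omega> by (intro conjI; simp add: field_simps)
qed

end

section \<open>The compatibility identity\<close>

lemma log_deriv_upd:
  assumes "j \<le> M"
  shows "log_deriv M Z (\<rho>(j := \<rho> j + c)) u = log_deriv M Z \<rho> u + c / (u - Z j)"
proof -
  have "(\<Sum>k\<le>M. (\<rho>(j := \<rho> j + c)) k / (u - Z k))
      = (\<Sum>k\<le>M. \<rho> k / (u - Z k) + (if k = j then c / (u - Z j) else 0))"
    by (rule sum.cong) (auto simp: add_divide_distrib)
  then show ?thesis
    using assms by (simp add: log_deriv_def sum.distrib)
qed

text \<open>\<open>spectral_matrix\<close> yields information only in the presence of a branch; the
  exponential of a primitive of the logarithmic derivative on a disc provides one.\<close>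

lemma local_branch_exists:
  assumes "z \<notin> Z ` {..M}"
  obtains \<omega> where "local_branch M Z \<rho> \<omega> z"
proof -
  have "open (- Z ` {..M})"
    by (simp add: finite_imp_closed open_Compl)
  then obtain e where e: "e > 0" "ball z e \<subseteq> - Z ` {..M}"
    using assms open_contains_ball_eq [of "- Z ` {..M}" z] by auto
  then have "log_deriv M Z \<rho> holomorphic_on ball z e"
    unfolding log_deriv_def by (intro holomorphic_intros) auto
  then obtain g where g: "\<And>u. u \<in> ball z e \<Longrightarrow> (g has_field_derivative log_deriv M Z \<rho> u) (at u within ball z e)"
    using holomorphic_convex_primitive' [OF convex_ball open_ball] by blast
  have "((\<lambda>u. exp (g u)) has_field_derivative exp (g u) * log_deriv M Z \<rho> u) (at u)" if "u \<in> ball z e" for u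
  proof (rule DERIV_fun_exp)
    show "(g has_field_derivative log_deriv M Z \<rho> u) (at u)"
      using g [OF that] that by (simp only: at_within_open [OF _ open_ball])
  qed
  moreover have "\<forall>\<^sub>F u in nhds z. u \<in> ball z e"
    using e(1) by (intro eventually_nhds_in_open) auto
  ultimately have "local_branch M Z \<rho> (\<lambda>u. exp (g u)) z"
    unfolding local_branch_def by (simp add: eventually_mono)
  then show ?thesis
    by (rule that)
qed

text \<open>The branch for the shifted weight is tied to that of w by the factor (z - s)^(+-1), so
  that Y^+- = R Y holds without a constant in the second column.\<close>

lemma local_branch_shift:
  assumes \<omega>: "local_branch M Z \<rho> \<omega> z" and j: "j \<le> M" "z \<noteq> Z j"
  shows "local_branch M Z (\<rho>(j := \<rho> j + 1)) (\<lambda>u. (u - Z j) * \<omega> u) z"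
    and "local_branch M Z (\<rho>(j := \<rho> j - 1)) (\<lambda>u. \<omega> u / (u - Z j)) z"
proof -
  have minus: "\<rho>(j := \<rho> j - 1) = \<rho>(j := \<rho> j + (- 1))"
    by simp
  have ne: "\<forall>\<^sub>F u in nhds z. u \<noteq> Z j"
    using j(2) by (rule t1_space_nhds)
  from \<omega> [unfolded local_branch_def] ne
  show "local_branch M Z (\<rho>(j := \<rho> j + 1)) (\<lambda>u. (u - Z j) * \<omega> u) z"
    unfolding local_branch_def log_deriv_upd [OF j(1)]
  proof eventually_elim
    case (elim u)
    then have \<omega>u: "\<omega> u \<noteq> 0" "(\<omega> has_field_derivative \<omega> u * log_deriv M Z \<rho> u) (at u)" "u - Z j \<noteq> 0"
      by auto
    have "((\<lambda>u. (u - Z j) * \<omega> u) has_field_derivative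
        (u - Z j) * \<omega> u * (log_deriv M Z \<rho> u + 1 / (u - Z j))) (at u)"
      by (rule DERIV_cong [OF DERIV_mult [OF DERIV_diff [OF DERIV_ident DERIV_const] \<omega>u(2)]])
         (use \<omega>u(3) in \<open>simp add: distrib_left mult_ac\<close>)
    then show ?case
      using \<omega>u by simp
  qed
  from \<omega> [unfolded local_branch_def] ne
  show "local_branch M Z (\<rho>(j := \<rho> j - 1)) (\<lambda>u. \<omega> u / (u - Z j)) z"
    unfolding local_branch_def minus log_deriv_upd [OF j(1)]
  proof eventually_elim
    case (elim u)
    then have \<omega>u: "\<omega> u \<noteq> 0" "(\<omega> has_field_derivative \<omega> u * log_deriv M Z \<rho> u) (at u)" "u - Z j \<noteq> 0"
      by auto
    have "((\<lambda>u. \<omega> u / (u - Z j)) has_field_derivative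
        \<omega> u / (u - Z j) * (log_deriv M Z \<rho> u + - 1 / (u - Z j))) (at u)"
      by (rule DERIV_cong [OF DERIV_divide [OF \<omega>u(2) DERIV_diff [OF DERIV_ident DERIV_const] \<omega>u(3)]])
         (use \<omega>u(3) in \<open>simp add: field_simps\<close>)
    then show ?case
      using \<omega>u by simp
  qed
qed

lemma mderiv_cong:
  assumes "\<forall>\<^sub>F u in nhds z. F u = G u"
  shows "mderiv F z = mderiv G z"
proof -
  have "deriv (\<lambda>u. F u $ i $ k) z = deriv (\<lambda>u. G u $ i $ k) z" for i k
    by (rule deriv_cong_ev [OF eventually_mono [OF assms]]) simp_all
  then show ?thesis
    by (simp add: mderiv_def)
qed

lemma mderiv_mult:
  fixes F G :: "complex \<Rightarrow> complex ^ 2 ^ 2"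
  assumes "\<And>i k. (\<lambda>u. F u $ i $ k) field_differentiable at z"
    and "\<And>i k. (\<lambda>u. G u $ i $ k) field_differentiable at z"
  shows "mderiv (\<lambda>u. F u ** G u) z = mderiv F z ** G z + F z ** mderiv G z"
  by (simp add: vec_eq_iff mderiv_def matrix_matrix_mult_def sum_2 assms deriv_add deriv_mult
      field_differentiable_add field_differentiable_mult algebra_simps)

lemma gauge_transformation:
  fixes Y Y1 R :: "complex \<Rightarrow> complex ^ 2 ^ 2"
  assumes Y1: "\<forall>\<^sub>F u in nhds z. Y1 u = R u ** Y u"
    and diff: "\<And>i k. (\<lambda>u. R u $ i $ k) field_differentiable at z"
      "\<And>i k. (\<lambda>u. Y u $ i $ k) field_differentiable at z"
    and ode: "mderiv Y z = A ** Y z" "mderiv Y1 z = A1 ** Y1 z"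
    and det: "det (Y z) \<noteq> 0"
  shows "mderiv R z + R z ** A = A1 ** R z"
proof -
  have "mderiv Y1 z = mderiv R z ** Y z + R z ** (A ** Y z)"
    using mderiv_cong [OF Y1] mderiv_mult [OF diff] ode(1) by simp
  moreover have "Y1 z = R z ** Y z"
    using Y1 by (rule eventually_nhds_x_imp_x)
  moreover have "(B + C) ** D = B ** D + C ** D" for B C D :: "complex ^ 2 ^ 2"
    by (simp add: vec_eq_iff matrix_matrix_mult_def sum.distrib distrib_right)
  ultimately have eq: "(mderiv R z + R z ** A) ** Y z = (A1 ** R z) ** Y z"
    using ode(2) by (simp add: matrix_mul_assoc)
  obtain Yi where Yi: "Y z ** Yi = mat 1"
    using det invertible_det_nz invertible_def by blast
  show ?thesis
    using arg_cong [OF eq, of "\<lambda>B. B ** Yi"] by (simp add: Yi flip: matrix_mul_assoc)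
qed

section \<open>Passage to the points of the circle\<close>

lemma isCont_matrix_mult:
  fixes F G :: "complex \<Rightarrow> complex ^ 2 ^ 2"
  assumes "isCont F z" "isCont G z"
  shows "isCont (\<lambda>u. F u ** G u) z"
  using assms unfolding isCont_def matrix_matrix_mult_def
  by (intro tendsto_vec_lambda tendsto_sum tendsto_mult tendsto_vec_nth)

lemma isCont_mderiv:
  fixes F :: "complex \<Rightarrow> complex ^ 2 ^ 2"
  assumes "\<And>i k. (\<lambda>u. F u $ i $ k) holomorphic_on S" "open S" "z \<in> S"
  shows "isCont F z" "isCont (mderiv F) z"
proof -
  have "isCont (\<lambda>u. F u $ i $ k) z" for i k
    using holomorphic_on_imp_continuous_on [OF assms(1)] assms(2,3) by (simp add: continuous_on_eq_continuous_at)
  then show "isCont F z"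
    unfolding isCont_def by (intro vec_tendstoI)
  have "isCont (deriv (\<lambda>u. F u $ i $ k)) z" for i k
    using holomorphic_on_imp_continuous_on [OF holomorphic_deriv [OF assms(1,2)]] assms(2,3)
    by (simp add: continuous_on_eq_continuous_at)
  then show "isCont (mderiv F) z"
    unfolding isCont_def mderiv_def by (intro tendsto_vec_lambda)
qed

text \<open>The defect of the identity is continuous at a point z of the circle, since
  \<open>R\<close> is holomorphic there, and vanishes at r z for positive r near 1, r distinct from
  1: such points are off the circle and, \<open>N\<close> being finite, off
  \<open>N\<close>.\<close>

lemma gauge_identity_extends:
  fixes R :: "complex \<Rightarrow> complex ^ 2 ^ 2"
  assumes N: "finite N" and z: "z \<notin> N"
    and hol: "\<And>i k. (\<lambda>u. R u $ i $ k) holomorphic_on - N"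
    and off: "\<And>u. u \<notin> unit_circle \<Longrightarrow> u \<notin> N \<Longrightarrow> mderiv R u + R u ** A u = A1 u ** R u"
    and cont: "z \<in> unit_circle \<Longrightarrow> isCont A z \<and> isCont A1 z"
  shows "mderiv R z + R z ** A z = A1 z ** R z"
proof (cases "z \<in> unit_circle")
  case True
  have opn: "open (- N)"
    by (simp add: N finite_imp_closed open_Compl)
  note R = isCont_mderiv [OF hol opn, of z]
  define D where "D u = mderiv R u + R u ** A u - A1 u ** R u" for u
  have "isCont D z"
    unfolding D_def using R cont [OF True] z by (intro continuous_intros isCont_matrix_mult) auto
  moreover have rz: "((\<lambda>r::real. of_real r * z) \<longlongrightarrow> z) (at 1)"
    by (auto intro!: tendsto_eq_intros)
  ultimately have lim: "((\<lambda>r::real. D (of_real r * z)) \<longlongrightarrow> D z) (at 1)"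
    by (rule isCont_tendsto_compose)
  have "((\<lambda>r::real. D (of_real r * z)) \<longlongrightarrow> 0) (at 1)"
  proof (rule tendsto_eventually)
    have "\<forall>\<^sub>F r in at 1. of_real r * z \<in> - N"
      using topological_tendstoD [OF rz opn] z by simp
    moreover have "\<forall>\<^sub>F r::real in at 1. r \<in> {0<..}"
      by (intro eventually_at_in_open') auto
    ultimately show "\<forall>\<^sub>F r::real in at 1. D (of_real r * z) = 0"
      using eventually_neq_at_within [of 1 1 UNIV]
    proof eventually_elim
      case (elim r)
      then have "of_real r * z \<notin> unit_circle"
        using True by (simp add: norm_mult)
      with elim show ?case
        by (simp add: D_def off)
    qed
  qed
  then have "D z = 0"
    by (rule tendsto_unique [OF at_neq_bot lim])
  then show ?thesis
    by (simp add: D_def)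
qed (use off z in blast)

context biorth
begin

lemma xi_holomorphic: "xi w \<phi> n holomorphic_on - unit_circle"
  and xi_star_holomorphic: "xi_star w \<phi>b n holomorphic_on - unit_circle"
proof -
  note T = cauchy_transform_holomorphic [OF w]
  show "xi w \<phi> n holomorphic_on - unit_circle"
    by (rule holomorphic_transform [where f = "\<lambda>z. 2 * T (pCons 0 (\<phi> n)) z"])
       (auto intro!: holomorphic_intros T simp: xi_eq)
  show "xi_star w \<phi>b n holomorphic_on - unit_circle"
    by (rule holomorphic_transform [where f = "\<lambda>z. - 2 * z * T (\<phi>s n) z"])
       (auto intro!: holomorphic_intros T simp: xi_star_eq)
qed

lemma Y_mat_differentiable:
  assumes z: "z \<notin> unit_circle" and \<omega>: "local_branch M Z \<rho> \<omega> z"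
  shows "(\<lambda>u. Y_mat w \<omega> \<phi> \<phi>b n u $ i $ l) field_differentiable at z"
proof -
  have \<omega>': "\<omega> z \<noteq> 0" "\<omega> field_differentiable at z"
    using eventually_nhds_x_imp_x [OF \<omega> [unfolded local_branch_def]] field_differentiable_def by blast+
  have opn: "open (- unit_circle)"
    by (simp add: open_Compl)
  have x: "xi w \<phi> n field_differentiable at z" "xi_star w \<phi>b n field_differentiable at z"
    using z by (auto intro!: holomorphic_on_imp_differentiable_at [OF _ opn] xi_holomorphic xi_star_holomorphic)
  have p: "poly q field_differentiable at z" for q
    using poly_DERIV field_differentiable_def by blast
  have "\<forall>i l. (\<lambda>u. Y_mat w \<omega> \<phi> \<phi>b n u $ i $ l) field_differentiable at z"
    using \<omega>' x by (simp add: forall_2 Y_mat_def mat2_def phi_star_def field_differentiable_divide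
        field_differentiable_minus p)
  then show ?thesis
    by blast
qed

lemma det_Y_mat_nonzero:
  assumes z: "z \<notin> unit_circle" "z \<noteq> 0" and \<omega>: "\<omega> z \<noteq> 0"
  shows "det (Y_mat w \<omega> \<phi> \<phi>b n z) \<noteq> 0"
proof -
  let ?c = "poly (\<phi> n) z * xi_star w \<phi>b n z + xi w \<phi> n z * poly (\<phi>s n) z"
  have "det (Y_mat w \<omega> \<phi> \<phi>b n z) * \<omega> z = - ?c"
    using \<omega> by (simp add: det_2 Y_mat_def mat2_def phi_star_def field_simps)
  moreover have "- ?c \<noteq> 0"
    using casoratian_nonzero [OF z, of n] by (simp only: neg_equal_0_iff_equal not_False_eq_True)
  ultimately show ?thesis
    by (metis mult_zero_left)
qed

text \<open>The part common to both signs. The relation \<open>Y\<close> is asked for only where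
  \<omega> does not vanish; this includes a neighbourhood of \<open>u\<close>, as differentiation
  requires.\<close>

lemma schlesinger_compatibility:
  fixes R :: "complex \<Rightarrow> complex ^ 2 ^ 2"
  assumes Z0: "Z 0 = 0" and u: "u \<notin> unit_circle" "u \<notin> Z ` {..M}"
    and A: "spectral_matrix M Z \<rho> w \<phi> \<phi>b n A"
    and A1: "spectral_matrix M Z \<rho>1 w1 \<phi>1 \<phi>b1 n A1"
    and \<omega>: "local_branch M Z \<rho> \<omega> u" and \<omega>1: "local_branch M Z \<rho>1 \<omega>1 u"
    and R: "\<And>i l. (\<lambda>u. R u $ i $ l) holomorphic_on - Z ` {..M}"
    and Y: "\<And>u. u \<notin> unit_circle \<Longrightarrow> u \<notin> Z ` {..M} \<Longrightarrow> \<omega> u \<noteq> 0 \<Longrightarrow>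
              Y_mat w1 \<omega>1 \<phi>1 \<phi>b1 n u = R u ** Y_mat w \<omega> \<phi> \<phi>b n u"
  shows "mderiv R u + R u ** A u = A1 u ** R u"
proof (rule gauge_transformation)
  let ?S = "- unit_circle \<inter> - Z ` {..M}"
  have opn: "open (- Z ` {..M})"
    by (simp add: finite_imp_closed open_Compl)
  have ev: "\<forall>\<^sub>F v in nhds u. v \<in> ?S"
    using u opn by (intro eventually_nhds_in_open open_Int) (auto simp: open_Compl)
  show "\<forall>\<^sub>F v in nhds u. Y_mat w1 \<omega>1 \<phi>1 \<phi>b1 n v = R v ** Y_mat w \<omega> \<phi> \<phi>b n v"
    using ev \<omega> [unfolded local_branch_def] by eventually_elim (use Y in auto)
  show "(\<lambda>u. R u $ i $ l) field_differentiable at u" for i l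
    using u(2) by (intro holomorphic_on_imp_differentiable_at [OF R opn]) auto
  show "(\<lambda>v. Y_mat w \<omega> \<phi> \<phi>b n v $ i $ l) field_differentiable at u" for i l
    by (rule Y_mat_differentiable [OF u(1) \<omega>])
  show "mderiv (Y_mat w \<omega> \<phi> \<phi>b n) u = A u ** Y_mat w \<omega> \<phi> \<phi>b n u"
    using A u \<omega> unfolding spectral_matrix_def by blast
  show "mderiv (Y_mat w1 \<omega>1 \<phi>1 \<phi>b1 n) u = A1 u ** Y_mat w1 \<omega>1 \<phi>1 \<phi>b1 n u"
    using A1 u \<omega>1 unfolding spectral_matrix_def by blast
  have "u \<noteq> 0"
    using u(2) Z0 by force
  moreover have "\<omega> u \<noteq> 0"
    using eventually_nhds_x_imp_x [OF \<omega> [unfolded local_branch_def]] by blast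
  ultimately show "det (Y_mat w \<omega> \<phi> \<phi>b n u) \<noteq> 0"
    by (rule det_Y_mat_nonzero [OF u(1)])
qed

end

lemma R_plus_holomorphic:
  assumes "s \<in> N"
  shows "(\<lambda>u. R_plus \<phi> \<phi>b \<phi>p s n u $ i $ k) holomorphic_on - N"
proof -
  have "\<forall>i k. (\<lambda>u. R_plus \<phi> \<phi>b \<phi>p s n u $ i $ k) holomorphic_on - N"
    using assms unfolding forall_2 R_plus_def Let_def mat2_def vector_2
    by (intro conjI holomorphic_intros) auto
  then show ?thesis
    by blast
qed

lemma R_minus_holomorphic: "(\<lambda>u. R_minus w \<phi> \<phi>b \<phi>m s n u $ i $ k) holomorphic_on S"
proof -
  have "\<forall>i k. (\<lambda>u. R_minus w \<phi> \<phi>b \<phi>m s n u $ i $ k) holomorphic_on S"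
    \<comment> \<open>All denominators are constants; as inverses they are constant factors and
      raise no nonvanishing conditions.\<close>
    unfolding forall_2 R_minus_def Let_def mat2_def vector_2 divide_inverse
    by (intro conjI holomorphic_intros)
  then show ?thesis
    by blast
qed

theorem proposition5p5:
  fixes M j n :: nat
    and Z \<rho> :: "nat \<Rightarrow> complex"
    and w :: "complex \<Rightarrow> complex"
    and \<phi> \<phi>b \<phi>p \<phi>bp \<phi>m \<phi>bm :: "nat \<Rightarrow> complex poly"
    and A Ap Am :: "complex \<Rightarrow> complex ^ 2 ^ 2"
  assumes "regular_semi_classical M Z \<rho> w"
    and "admissible w \<phi> \<phi>b"
    and "j \<le> M" and "Z j \<noteq> 0"
    and "spectral_matrix M Z \<rho> w \<phi> \<phi>b n A"
  shows
    "(admissible (\<lambda>\<zeta>. (\<zeta> - Z j) * w \<zeta>) \<phi>p \<phi>bp \<and>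
      (\<forall>m. poly (\<phi> m) (Z j) \<noteq> 0) \<and>
      spectral_matrix M Z (\<rho>(j := \<rho> j + 1)) (\<lambda>\<zeta>. (\<zeta> - Z j) * w \<zeta>) \<phi>p \<phi>bp n Ap
      \<longrightarrow> (\<forall>z. z \<notin> Z ` {..M} \<and> (z \<in> unit_circle \<longrightarrow> isCont A z \<and> isCont Ap z) \<longrightarrow>
            mderiv (R_plus \<phi> \<phi>b \<phi>p (Z j) n) z + R_plus \<phi> \<phi>b \<phi>p (Z j) n z ** A z
              = Ap z ** R_plus \<phi> \<phi>b \<phi>p (Z j) n z))
     \<and>
     (1 \<le> n \<and>
      admissible (\<lambda>\<zeta>. w \<zeta> / (\<zeta> - Z j)) \<phi>m \<phi>bm \<and>
      (\<forall>m. value_at (xi_star w \<phi>b m) (Z j) \<noteq> 0) \<and>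
      spectral_matrix M Z (\<rho>(j := \<rho> j - 1)) (\<lambda>\<zeta>. w \<zeta> / (\<zeta> - Z j)) \<phi>m \<phi>bm n Am
      \<longrightarrow> (\<forall>z. z \<notin> Z ` {..M} \<and> (z \<in> unit_circle \<longrightarrow> isCont A z \<and> isCont Am z) \<longrightarrow>
            mderiv (R_minus w \<phi> \<phi>b \<phi>m (Z j) n) z + R_minus w \<phi> \<phi>b \<phi>m (Z j) n z ** A z
              = Am z ** R_minus w \<phi> \<phi>b \<phi>m (Z j) n z))"
proof -
  interpret biorth w \<phi> \<phi>b
    by unfold_locales fact
  have Z0: "Z 0 = 0"
    using assms(1) by (simp add: regular_semi_classical_def)
  have Zj: "Z j \<in> Z ` {..M}"
    using assms(3) by blast
  have fin: "finite (Z ` {..M})"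
    by simp
  show ?thesis
  proof (intro conjI impI allI; elim conjE)
    fix z
    assume adm: "admissible (\<lambda>\<zeta>. (\<zeta> - Z j) * w \<zeta>) \<phi>p \<phi>bp" and nz: "\<forall>m. poly (\<phi> m) (Z j) \<noteq> 0"
      and Ap: "spectral_matrix M Z (\<rho>(j := \<rho> j + 1)) (\<lambda>\<zeta>. (\<zeta> - Z j) * w \<zeta>) \<phi>p \<phi>bp n Ap"
      and z: "z \<notin> Z ` {..M}" and cont: "z \<in> unit_circle \<longrightarrow> isCont A z \<and> isCont Ap z"
    interpret schlesinger_plus w \<phi> \<phi>b "Z j" \<phi>p \<phi>bp
      by unfold_locales (use adm nz assms(4) in auto)
    show "mderiv (R_plus \<phi> \<phi>b \<phi>p (Z j) n) z + R_plus \<phi> \<phi>b \<phi>p (Z j) n z ** A z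
              = Ap z ** R_plus \<phi> \<phi>b \<phi>p (Z j) n z"
    proof (rule gauge_identity_extends [OF fin z R_plus_holomorphic [OF Zj]])
      fix u assume u: "u \<notin> unit_circle" "u \<notin> Z ` {..M}"
      have "u \<noteq> Z j"
        using u(2) Zj by blast
      \<comment> \<open>Any branch serves, since the identity to be shown does not involve
        \<omega>.\<close>
      obtain \<omega> where \<omega>: "local_branch M Z \<rho> \<omega> u"
        using local_branch_exists [OF u(2)] .
      show "mderiv (R_plus \<phi> \<phi>b \<phi>p (Z j) n) u + R_plus \<phi> \<phi>b \<phi>p (Z j) n u ** A u
              = Ap u ** R_plus \<phi> \<phi>b \<phi>p (Z j) n u"
        by (rule schlesinger_compatibility [OF Z0 u assms(5) Ap \<omega>
              local_branch_shift(1) [OF \<omega> assms(3) \<open>u \<noteq> Z j\<close>] R_plus_holomorphic [OF Zj]])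
           (use Zj in \<open>auto intro!: Y_plus\<close>)
    qed (use cont in blast)
  next
    fix z
    assume n: "1 \<le> n"
      and adm: "admissible (\<lambda>\<zeta>. w \<zeta> / (\<zeta> - Z j)) \<phi>m \<phi>bm" and nz: "\<forall>m. value_at (xi_star w \<phi>b m) (Z j) \<noteq> 0"
      and Am: "spectral_matrix M Z (\<rho>(j := \<rho> j - 1)) (\<lambda>\<zeta>. w \<zeta> / (\<zeta> - Z j)) \<phi>m \<phi>bm n Am"
      and z: "z \<notin> Z ` {..M}" and cont: "z \<in> unit_circle \<longrightarrow> isCont A z \<and> isCont Am z"
    interpret schlesinger_minus w \<phi> \<phi>b "Z j" \<phi>m \<phi>bm
      by unfold_locales (use adm nz assms(4) in auto)
    show "mderiv (R_minus w \<phi> \<phi>b \<phi>m (Z j) n) z + R_minus w \<phi> \<phi>b \<phi>m (Z j) n z ** A z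
              = Am z ** R_minus w \<phi> \<phi>b \<phi>m (Z j) n z"
    proof (rule gauge_identity_extends [OF fin z R_minus_holomorphic])
      fix u assume u: "u \<notin> unit_circle" "u \<notin> Z ` {..M}"
      have "u \<noteq> Z j"
        using u(2) Zj by blast
      obtain \<omega> where \<omega>: "local_branch M Z \<rho> \<omega> u"
        using local_branch_exists [OF u(2)] .
      show "mderiv (R_minus w \<phi> \<phi>b \<phi>m (Z j) n) u + R_minus w \<phi> \<phi>b \<phi>m (Z j) n u ** A u
              = Am u ** R_minus w \<phi> \<phi>b \<phi>m (Z j) n u"
        by (rule schlesinger_compatibility [OF Z0 u assms(5) Am \<omega>
              local_branch_shift(2) [OF \<omega> assms(3) \<open>u \<noteq> Z j\<close>] R_minus_holomorphic])
           (use Zj n in \<open>auto intro!: Y_minus\<close>)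
    qed (use cont in blast)
  qed
qed

end
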